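(* For integers $p,d\ge0$, the bihamiltonian cohomology groups of $\hat{\mathcal A}$ for the dispersionless KdV Poisson pencil are $$BH^p_d(\hat{\mathcal A},D_1,D_2)=\begin{cases}\mathbb R & p=0,\ d=0,\\ C^\infty(\mathbb R)\,\theta\theta^1 & p=2,\ d=1,\\ C^\infty(\mathbb R)\,\theta\theta^1\theta^2 & p=3,\ d=3,\\ 0&\text{else.}\end{cases}$$
   Context: Let $\hat{\mathcal A}=C^\infty(\mathbb R)[[u^1,u^2,\dots;\theta^0,\theta^1,\theta^2,\dots]]$ be the supercommutative associative algebra over $\mathbb R$ with even formal variables $u^i$ ($i\ge1$) and odd (mutually anticommuting) formal variables $\theta^i$ ($i\ge 0$); elements of $C^\infty(\mathbb R)$ are smooth functions of a coordinate $u=u^0$ on $\mathbb R$, and $\theta=\theta^0$. The standard degree is given by $\deg u^i=\deg\theta^i=i$ for $i\ge 1$, and $\deg\theta^0=\deg f=0$ for $f\in C^\infty(\mathbb R)$. The super degree assigns $1$ to each $\theta^i$ ($i\ge0$) and $0$ to all other generators. $\hat{\mathcal A}^p_d$ is the subspace of elements of super degree $p$ and standard degree $d$ (zero if $p<0$ or $d<0$). Let $\partial=\sum_{s\ge0}\big(u^{s+1}\frac{\partial}{\partial u^s}+\theta^{s+1}\frac{\partial}{\partial\theta^s}\big)$. The Poisson structures $P_1=\frac12\int\theta\theta^1$ and $P_2=\frac12\int u\theta\theta^1$ of dispersionless KdV induce on $\hat{\mathcal A}$ the anticommuting differentials of bidegree $(p,d)=(1,1)$ given by the odd derivations $$D_1=\sum_{s\ge0}\theta^{s+1}\frac{\partial}{\partial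 u^s},\qquad D_2=\sum_{s\ge0}\Big(\partial^s\big(u\theta^1+\tfrac12u^1\theta\big)\frac{\partial}{\partial u^s}+\partial^s\big(\tfrac12\theta\theta^1\big)\frac{\partial}{\partial\theta^s}\Big).$$ The bihamiltonian cohomology is $BH(\hat{\mathcal A},D_1,D_2)=\frac{\ker D_1\cap\ker D_2}{\operatorname{Im}(D_1D_2)}$, with bigraded component $$BH^p_d(\hat{\mathcal A},D_1,D_2)=\frac{\ker(D_1|_{\hat{\mathcal A}^p_d})\cap\ker(D_2|_{\hat{\mathcal A}^p_d})}{D_1D_2(\hat{\mathcal A}^{p-2}_{d-2})}.$$ *)

theory Defs
  imports "HOL-Analysis.Analysis" "HOL-Library.Multiset"
begin

definition smooth :: "(real \<Rightarrow> real) \<Rightarrow> bool" where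
  "smooth f \<longleftrightarrow> (\<forall>n x. (deriv ^^ n) f field_differentiable (at x))"

definition cdiff :: "nat \<Rightarrow> (real \<Rightarrow> real) \<Rightarrow> bool" where
  "cdiff n f \<longleftrightarrow> (\<forall>k<n. \<forall>x. (deriv ^^ k) f field_differentiable (at x))"

lemma cdiff_0 [simp]: "cdiff 0 f"
  by (simp add: cdiff_def)

lemma cdiff_Suc: "cdiff (Suc n) f \<longleftrightarrow> (\<forall>x. f field_differentiable (at x)) \<and> cdiff n (deriv f)"
proof -
  have "cdiff (Suc n) f \<longleftrightarrow> (\<forall>k<Suc n. \<forall>x. (deriv ^^ k) f field_differentiable (at x))"
    by (simp add: cdiff_def)
  also have "\<dots> \<longleftrightarrow> (\<forall>x. f field_differentiable (at x)) \<and>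
      (\<forall>k<n. \<forall>x. (deriv ^^ Suc k) f field_differentiable (at x))"
    by (subst All_less_Suc2) simp
  finally show ?thesis
    by (simp add: cdiff_def funpow_Suc_right del: funpow.simps)
qed

lemma cdiff_mono: "cdiff (Suc n) f \<Longrightarrow> cdiff n f"
  by (simp add: cdiff_def)

lemma smooth_iff_cdiff: "smooth f \<longleftrightarrow> (\<forall>n. cdiff n f)"
  unfolding smooth_def cdiff_def by blast

lemma smooth_field_differentiable: "smooth f \<Longrightarrow> f field_differentiable (at x)"
  unfolding smooth_def by (metis funpow_0)

lemma smooth_deriv: "smooth f \<Longrightarrow> smooth (deriv f)"
  unfolding smooth_iff_cdiff using cdiff_Suc by blast

lemma cdiff_const: "cdiff n (\<lambda>x. c)"
  by (induction n arbitrary: c) (simp_all add: cdiff_Suc)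

lemma cdiff_id: "cdiff n (\<lambda>x. x)"
proof (cases n)
  case (Suc m)
  have "deriv (\<lambda>x::real. x) = (\<lambda>x. 1)" by (rule ext) simp
  then show ?thesis using Suc by (simp add: cdiff_Suc cdiff_const)
qed simp

lemma cdiff_add: "cdiff n f \<Longrightarrow> cdiff n g \<Longrightarrow> cdiff n (\<lambda>x. f x + g x)"
proof (induction n arbitrary: f g)
  case (Suc n)
  have "deriv (\<lambda>x. f x + g x) = (\<lambda>x. deriv f x + deriv g x)"
    using Suc.prems by (intro ext deriv_add) (simp_all add: cdiff_Suc)
  then show ?case
    using Suc by (simp add: cdiff_Suc field_differentiable_add)
qed simp

lemma cdiff_mult: "cdiff n f \<Longrightarrow> cdiff n g \<Longrightarrow> cdiff n (\<lambda>x. f x * g x)"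
proof (induction n arbitrary: f g)
  case (Suc n)
  have "deriv (\<lambda>x. f x * g x) = (\<lambda>x. f x * deriv g x + deriv f x * g x)"
    using Suc.prems by (intro ext deriv_mult) (simp_all add: cdiff_Suc)
  moreover have "cdiff n (\<lambda>x. f x * deriv g x)" "cdiff n (\<lambda>x. deriv f x * g x)"
    using Suc.prems cdiff_mono[OF Suc.prems(1)] cdiff_mono[OF Suc.prems(2)]
    by (simp_all add: Suc.IH cdiff_Suc)
  ultimately show ?case
    using Suc.prems by (simp add: cdiff_Suc field_differentiable_mult cdiff_add)
qed simp

lemma smooth_const: "smooth (\<lambda>x. c)"
  by (simp add: smooth_iff_cdiff cdiff_const)

lemma smooth_id: "smooth (\<lambda>x. x)"
  by (simp add: smooth_iff_cdiff cdiff_id)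

lemma smooth_add: "smooth f \<Longrightarrow> smooth g \<Longrightarrow> smooth (\<lambda>x. f x + g x)"
  by (simp add: smooth_iff_cdiff cdiff_add)

lemma smooth_mult: "smooth f \<Longrightarrow> smooth g \<Longrightarrow> smooth (\<lambda>x. f x * g x)"
  by (simp add: smooth_iff_cdiff cdiff_mult)

lemma smooth_uminus: "smooth f \<Longrightarrow> smooth (\<lambda>x. - f x)"
  using smooth_mult[OF smooth_const[of "-1"]] by simp

lemma smooth_diff: "smooth f \<Longrightarrow> smooth g \<Longrightarrow> smooth (\<lambda>x. f x - g x)"
  using smooth_add[of f "\<lambda>x. - g x"] by (simp add: smooth_uminus)

typedef cinf = "{f. smooth f}"
  morphisms cfun Cinf
  using smooth_const by blast

setup_lifting type_definition_cinf

lemma cinf_eqI: "(\<And>x. cfun f x = cfun g x) \<Longrightarrow> f = g"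
  by (metis cfun_inject ext)

instantiation cinf :: "{comm_ring_1, real_algebra_1}"
begin

lift_definition zero_cinf :: cinf is "\<lambda>x. 0" by (rule smooth_const)
lift_definition one_cinf :: cinf is "\<lambda>x. 1" by (rule smooth_const)
lift_definition plus_cinf :: "cinf \<Rightarrow> cinf \<Rightarrow> cinf" is "\<lambda>f g x. f x + g x" by (rule smooth_add)
lift_definition minus_cinf :: "cinf \<Rightarrow> cinf \<Rightarrow> cinf" is "\<lambda>f g x. f x - g x" by (rule smooth_diff)
lift_definition uminus_cinf :: "cinf \<Rightarrow> cinf" is "\<lambda>f x. - f x" by (rule smooth_uminus)
lift_definition times_cinf :: "cinf \<Rightarrow> cinf \<Rightarrow> cinf" is "\<lambda>f g x. f x * g x" by (rule smooth_mult)
lift_definition scaleR_cinf :: "real \<Rightarrow> cinf \<Rightarrow> cinf" is "\<lambda>c f x. c * f x"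
  by (rule smooth_mult[OF smooth_const])

instance
  by standard (transfer; auto simp: fun_eq_iff algebra_simps)+

end

lift_definition coord :: cinf is "\<lambda>x. x" by (rule smooth_id)

lift_definition cderiv :: "cinf \<Rightarrow> cinf" is deriv by (rule smooth_deriv)

lemma cderiv_0 [simp]: "cderiv 0 = 0"
  by transfer (auto simp: fun_eq_iff)

text \<open>
  A monomial is a pair \<open>(a, S)\<close>: the multiset \<open>a\<close> lists the indices \<open>i \<ge> 1\<close> of its even factors
  \<open>u^i\<close>, and \<open>S = {s1 < \<dots> < sk}\<close> stands for the ordered product
  \<open>\<theta>^s1 \<dots> \<theta>^sk\<close>. An element of the algebra is an arbitrary family of smooth coefficients indexed
  by monomials. Pairs that are not monomials (\<open>0 \<in># a\<close>, or \<open>S\<close> infinite) have coefficient \<open>0\<close>.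
\<close>

typedef ahat = "{f :: nat multiset \<Rightarrow> nat set \<Rightarrow> cinf. \<forall>a S. f a S \<noteq> 0 \<longrightarrow> 0 \<notin># a \<and> finite S}"
  morphisms coeff Ahat
  by (rule exI[of _ "\<lambda>_ _. 0"]) simp

setup_lifting type_definition_ahat

lemma ahat_eqI: "(\<And>a S. coeff f a S = coeff g a S) \<Longrightarrow> f = g"
  by (metis coeff_inject ext)

lemma coeff_eq_0: "0 \<in># a \<or> infinite S \<Longrightarrow> coeff f a S = 0"
  using coeff[of f] by auto

text \<open>\<open>\<theta>\<^sup>T \<theta>\<^sup>R = ksign T R \<theta>\<^bsup>T \<union> R\<^esup>\<close> for disjoint \<open>T\<close> and \<open>R\<close>.\<close>

definition ksign :: "nat set \<Rightarrow> nat set \<Rightarrow> cinf" where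
  "ksign T R = (-1) ^ card {(i, j). i \<in> T \<and> j \<in> R \<and> j < i}"

lemma finite_inversions: "finite T \<Longrightarrow> finite R \<Longrightarrow> finite {(i, j). i \<in> T \<and> j \<in> R \<and> j < (i::nat)}"
  by (rule finite_subset[of _ "T \<times> R"]) auto

lemma ksign_empty [simp]: "ksign {} S = 1" "ksign S {} = 1"
  by (simp_all add: ksign_def)

lemma ksign_Un_left:
  assumes "finite T" "finite R" "finite W" "T \<inter> R = {}"
  shows "ksign (T \<union> R) W = ksign T W * ksign R W"
proof -
  have "{(i, j). i \<in> T \<union> R \<and> j \<in> W \<and> j < i} =
    {(i, j). i \<in> T \<and> j \<in> W \<and> j < i} \<union> {(i, j). i \<in> R \<and> j \<in> W \<and> j < i}" by auto
  moreover have "{(i, j). i \<in> T \<and> j \<in> W \<and> j < i} \<inter> {(i, j). i \<in> R \<and> j \<in> W \<and> j < i} = {}"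
    using assms by auto
  ultimately show ?thesis
    using assms by (simp add: ksign_def card_Un_disjoint finite_inversions power_add)
qed

lemma ksign_Un_right:
  assumes "finite T" "finite R" "finite W" "R \<inter> W = {}"
  shows "ksign T (R \<union> W) = ksign T R * ksign T W"
proof -
  have "{(i, j). i \<in> T \<and> j \<in> R \<union> W \<and> j < i} =
    {(i, j). i \<in> T \<and> j \<in> R \<and> j < i} \<union> {(i, j). i \<in> T \<and> j \<in> W \<and> j < i}" by auto
  moreover have "{(i, j). i \<in> T \<and> j \<in> R \<and> j < i} \<inter> {(i, j). i \<in> T \<and> j \<in> W \<and> j < i} = {}"
    using assms by auto
  ultimately show ?thesis
    using assms by (simp add: ksign_def card_Un_disjoint finite_inversions power_add)
qed

definition splits :: "nat multiset \<Rightarrow> nat set \<Rightarrow> (nat multiset \<times> nat set) set" where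
  "splits a S = {b. b \<subseteq># a} \<times> Pow S"

definition mulc :: "(nat multiset \<Rightarrow> nat set \<Rightarrow> cinf) \<Rightarrow> (nat multiset \<Rightarrow> nat set \<Rightarrow> cinf) \<Rightarrow>
    nat multiset \<Rightarrow> nat set \<Rightarrow> cinf" where
  "mulc f g a S = (\<Sum>(b, T) \<in> splits a S. ksign T (S - T) * f b T * g (a - b) (S - T))"

lemma finite_submultisets: "finite {b. b \<subseteq># (a :: 'a multiset)}"
proof (induction a)
  case (add x a)
  have "{b. b \<subseteq># add_mset x a} \<subseteq> {b. b \<subseteq># a} \<union> add_mset x ` {b. b \<subseteq># a}"
  proof
    fix b assume b: "b \<in> {b. b \<subseteq># add_mset x a}"
    show "b \<in> {b. b \<subseteq># a} \<union> add_mset x ` {b. b \<subseteq># a}"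
    proof (cases "x \<in># b")
      case True
      then obtain c where "b = add_mset x c" by (metis insert_DiffM)
      then show ?thesis using b by auto
    next
      case False
      then show ?thesis using b by (auto simp: subseteq_mset_def not_in_iff split: if_splits)
        (metis le0)
    qed
  qed
  then show ?case using add by (meson finite_UnI finite_imageI finite_subset)
qed simp

lemma finite_splits: "finite S \<Longrightarrow> finite (splits a S)"
  unfolding splits_def by (simp add: finite_submultisets)

lemma mulc_infinite: "infinite S \<Longrightarrow> mulc f g a S = 0"
proof -
  assume "infinite S"
  moreover have "{b. b \<subseteq># a} \<noteq> {}" by (auto intro: exI[of _ "{#}"])
  ultimately have "infinite (splits a S)"
    unfolding splits_def by (simp add: finite_cartesian_product_iff Pow_not_empty)
  then show ?thesis by (simp add: mulc_def)
qed

lemma mulc_0: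
  assumes "\<And>a S. f a S \<noteq> 0 \<Longrightarrow> 0 \<notin># a" "\<And>a S. g a S \<noteq> 0 \<Longrightarrow> 0 \<notin># a" "0 \<in># a"
  shows "mulc f g a S = 0"
  unfolding mulc_def
proof (rule sum.neutral, clarsimp simp: splits_def)
  fix b T assume "b \<subseteq># a" and T: "T \<subseteq> S"
  then have "0 \<in># b \<or> 0 \<in># a - b"
    using assms(3) by (metis subset_mset.add_diff_inverse union_iff)
  then show "ksign T (S - T) * f b T * g (a - b) (S - T) = 0"
    using assms(1)[of b T] assms(2)[of "a - b" "S - T"] by (metis mult_zero_left mult_zero_right)
qed

lemma mulc_assoc:
  assumes "finite S"
  shows "mulc (mulc f g) h a S = mulc f (mulc g h) a S"
proof -
  let ?L = "Sigma (splits a S) (\<lambda>(b, T). splits b T)"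
  let ?R = "Sigma (splits a S) (\<lambda>(c, R). splits (a - c) (S - R))"
  have fin: "\<And>T. T \<subseteq> S \<Longrightarrow> finite T" using assms by (rule rev_finite_subset)
  have "mulc (mulc f g) h a S = (\<Sum>(b, T) \<in> splits a S. \<Sum>(c, R) \<in> splits b T.
      ksign T (S - T) * (ksign R (T - R) * f c R * g (b - c) (T - R)) * h (a - b) (S - T))"
    unfolding mulc_def by (intro sum.cong refl) (auto simp: sum_distrib_left sum_distrib_right intro!: sum.cong)
  also have "\<dots> = (\<Sum>((b, T), (c, R)) \<in> ?L.
      ksign T (S - T) * (ksign R (T - R) * f c R * g (b - c) (T - R)) * h (a - b) (S - T))"
    by (subst sum.Sigma[symmetric])
       (auto simp: finite_splits assms fin splits_def finite_submultisets split_def)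
  also have "\<dots> = (\<Sum>((c, R), (e, W)) \<in> ?R.
      ksign R (S - R) * f c R * (ksign W (S - R - W) * g e W * h (a - c - e) (S - R - W)))"
  proof (rule sum.reindex_bij_witness[of _
        "\<lambda>((c, R), (e, W)). ((c + e, R \<union> W), (c, R))"
        "\<lambda>((b, T), (c, R)). ((c, R), (b - c, T - R))"], goal_cases)
    case (1 x) then show ?case by (auto simp: splits_def)
  next
    case (2 x)
    then show ?case
      by (auto simp: splits_def intro: subset_mset.order_trans)
         (metis subset_mset.diff_add_assoc2 subset_mset.le_diff_conv2 subset_mset.order_trans
           subset_mset.diff_add)+
  next
    case (3 x) then show ?case by (auto simp: splits_def)
  next
    case (4 x)
    then show ?case
      by (auto simp: splits_def)
         (metis subset_mset.add_le_cancel_left subset_mset.add_diff_inverse)+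
  next
    case (5 x)
    obtain b T c R where x: "x = ((b, T), (c, R))" by (cases x) auto
    have s: "b \<subseteq># a" "T \<subseteq> S" "c \<subseteq># b" "R \<subseteq> T" using 5 x by (auto simp: splits_def)
    have f: "finite T" "finite R" "finite (T - R)" "finite (S - T)" "finite S"
      using s assms fin by auto
    have e1: "S - R = (T - R) \<union> (S - T)" "S - R - (T - R) = S - T" using s by auto
    have e2: "a - (c + (b - c)) = a - b" using s
      by (metis subset_mset.add_diff_inverse)
    have k1: "ksign T (S - T) = ksign R (S - T) * ksign (T - R) (S - T)"
      using ksign_Un_left[of R "T - R" "S - T"] f s by (simp add: Un_absorb1)
    have k2: "ksign R (S - R) = ksign R (T - R) * ksign R (S - T)"
      unfolding e1(1) by (rule ksign_Un_right) (use f in auto)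
    show ?case unfolding x by (simp add: e1(2) e2 k1 k2 mult_ac)
  qed
  also have "\<dots> = (\<Sum>(c, R) \<in> splits a S. \<Sum>(e, W) \<in> splits (a - c) (S - R).
      ksign R (S - R) * f c R * (ksign W (S - R - W) * g e W * h (a - c - e) (S - R - W)))"
    by (subst sum.Sigma[symmetric])
       (auto simp: finite_splits assms fin splits_def finite_submultisets split_def)
  also have "\<dots> = mulc f (mulc g h) a S"
    unfolding mulc_def by (intro sum.cong refl) (auto simp: sum_distrib_left intro!: sum.cong)
  finally show ?thesis .
qed

definition monc :: "cinf \<Rightarrow> nat multiset \<Rightarrow> nat set \<Rightarrow> nat multiset \<Rightarrow> nat set \<Rightarrow> cinf" where
  "monc f a S = (\<lambda>b T. if b = a \<and> T = S then f else 0)"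

lemma mulc_one_left:
  assumes S: "finite S"
  shows "mulc (monc 1 {#} {}) g a S = g a S"
proof -
  have "mulc (monc 1 {#} {}) g a S =
      (\<Sum>x \<in> splits a S. if x = ({#}, {}) then g a S else 0)"
    unfolding mulc_def by (intro sum.cong refl) (auto simp: monc_def split: if_splits)
  also have "\<dots> = g a S"
    by (subst sum.delta[OF finite_splits[OF S]]) (simp add: splits_def)
  finally show ?thesis .
qed

lemma mulc_one_right:
  assumes S: "finite S"
  shows "mulc g (monc 1 {#} {}) a S = g a S"
proof -
  have "mulc g (monc 1 {#} {}) a S =
      (\<Sum>x \<in> splits a S. if x = (a, S) then g a S else 0)"
    unfolding mulc_def
  proof (intro sum.cong refl, clarify)
    fix b T assume "(b, T) \<in> splits a S"
    then have "a - b = {#} \<and> S - T = {} \<longleftrightarrow> b = a \<and> T = S"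
      by (auto simp: splits_def Diff_eq_empty_iff_mset)
    then show "ksign T (S - T) * g b T * monc 1 {#} {} (a - b) (S - T) =
        (if (b, T) = (a, S) then g a S else 0)"
      by (auto simp: monc_def)
  qed
  also have "\<dots> = g a S"
    by (subst sum.delta[OF finite_splits[OF S]]) (simp add: splits_def)
  finally show ?thesis .
qed

instantiation ahat :: real_algebra_1
begin

lift_definition zero_ahat :: ahat is "\<lambda>a S. 0" by simp
lift_definition one_ahat :: ahat is "monc 1 {#} {}" by (auto simp: monc_def split: if_splits)
lift_definition plus_ahat :: "ahat \<Rightarrow> ahat \<Rightarrow> ahat" is "\<lambda>f g a S. f a S + g a S"
  by (metis add.right_neutral)
lift_definition minus_ahat :: "ahat \<Rightarrow> ahat \<Rightarrow> ahat" is "\<lambda>f g a S. f a S - g a S"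
  by (metis diff_zero)
lift_definition uminus_ahat :: "ahat \<Rightarrow> ahat" is "\<lambda>f a S. - f a S"
  by simp
lift_definition times_ahat :: "ahat \<Rightarrow> ahat \<Rightarrow> ahat" is mulc
proof -
  fix f g :: "nat multiset \<Rightarrow> nat set \<Rightarrow> cinf" and a S
  assume f: "\<And>a S. f a S \<noteq> 0 \<Longrightarrow> 0 \<notin># a \<and> finite S"
    and g: "\<And>a S. g a S \<noteq> 0 \<Longrightarrow> 0 \<notin># a \<and> finite S"
    and nz: "mulc f g a S \<noteq> 0"
  show "0 \<notin># a \<and> finite S"
    using mulc_0[of f g a S] mulc_infinite[of S f g a] f g nz by blast
qed
lift_definition scaleR_ahat :: "real \<Rightarrow> ahat \<Rightarrow> ahat" is "\<lambda>c f a S. c *\<^sub>R f a S"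
  by (metis scaleR_zero_right)

instance
proof
  fix f g h :: ahat and c c' :: real
  show "f * g * h = f * (g * h)"
  proof (rule ahat_eqI)
    fix a S
    show "coeff (f * g * h) a S = coeff (f * (g * h)) a S"
      by (cases "finite S") (simp_all add: times_ahat.rep_eq mulc_assoc mulc_infinite)
  qed
  show "1 * f = f"
  proof (rule ahat_eqI)
    fix a S
    show "coeff (1 * f) a S = coeff f a S"
      by (cases "finite S")
         (simp_all add: times_ahat.rep_eq one_ahat.rep_eq mulc_one_left mulc_infinite coeff_eq_0)
  qed
  show "f * 1 = f"
  proof (rule ahat_eqI)
    fix a S
    show "coeff (f * 1) a S = coeff f a S"
      by (cases "finite S")
         (simp_all add: times_ahat.rep_eq one_ahat.rep_eq mulc_one_right mulc_infinite coeff_eq_0)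
  qed
  show "(f + g) * h = f * h + g * h"
    by (rule ahat_eqI) (simp add: times_ahat.rep_eq plus_ahat.rep_eq mulc_def split_def
      algebra_simps sum.distrib)
  show "f * (g + h) = f * g + f * h"
    by (rule ahat_eqI) (simp add: times_ahat.rep_eq plus_ahat.rep_eq mulc_def split_def
      algebra_simps sum.distrib)
  show "c *\<^sub>R f * g = c *\<^sub>R (f * g)"
    by (rule ahat_eqI) (simp add: times_ahat.rep_eq scaleR_ahat.rep_eq mulc_def split_def
      scaleR_sum_right)
  show "f * c *\<^sub>R g = c *\<^sub>R (f * g)"
    by (rule ahat_eqI) (simp add: times_ahat.rep_eq scaleR_ahat.rep_eq mulc_def split_def
      scaleR_sum_right)
  show "(0::ahat) \<noteq> 1"
    by transfer (auto simp: monc_def fun_eq_iff)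
qed (transfer; auto simp: fun_eq_iff algebra_simps)+

end

lift_definition func :: "cinf \<Rightarrow> ahat" is "\<lambda>f. monc f {#} {}"
  by (auto simp: monc_def split: if_splits)

lift_definition theta :: "nat \<Rightarrow> ahat" is "\<lambda>s. monc 1 {#} {s}"
  by (auto simp: monc_def split: if_splits)

lift_definition upos :: "nat \<Rightarrow> ahat" is "\<lambda>s. if s = 0 then (\<lambda>_ _. 0) else monc 1 {#s#} {}"
  by (auto simp: monc_def split: if_splits)

definition uvar :: "nat \<Rightarrow> ahat" where
  "uvar s = (if s = 0 then func coord else upos s)"

definition mdeg :: "nat multiset \<Rightarrow> nat set \<Rightarrow> nat" where
  "mdeg a S = sum_mset a + \<Sum>S"

definition acomp :: "int \<Rightarrow> int \<Rightarrow> ahat set" where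
  "acomp p d = {f. \<forall>a S. coeff f a S \<noteq> 0 \<longrightarrow> int (card S) = p \<and> int (mdeg a S) = d}"

text \<open>\<open>du 0\<close> is the derivative in the coordinate of the real line; \<open>dtheta\<close> is the left derivative.\<close>

lift_definition du :: "nat \<Rightarrow> ahat \<Rightarrow> ahat" is
  "\<lambda>s f a S. if s = 0 then cderiv (f a S)
     else of_nat (count a s + 1) * f (add_mset s a) S"
  by (auto split: if_splits; metis cderiv_0 mult_zero_right union_iff add_mset_add_single)

lift_definition dtheta :: "nat \<Rightarrow> ahat \<Rightarrow> ahat" is
  "\<lambda>s f a S. if s \<in> S then 0 else (-1) ^ card {j \<in> S. j < s} * f a (insert s S)"
  by (auto split: if_splits; metis mult_zero_right finite_insert)

text \<open>
  Coefficientwise sum of a sequence of series, meant for sequences in which every monomial occurs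
  in only finitely many terms. The lemmas \<open>finite_terms_tot\<close>, \<open>finite_terms_D1\<close> and
  \<open>finite_terms_D2\<close> below show that this is so for \<open>tot\<close>, \<open>D1\<close> and \<open>D2\<close>.
\<close>

lift_definition fsum :: "(nat \<Rightarrow> ahat) \<Rightarrow> ahat" is
  "\<lambda>F a S. \<Sum>s | F s a S \<noteq> 0. F s a S"
  by (metis (mono_tags, lifting) mem_Collect_eq sum.not_neutral_contains_not_neutral)

text \<open>The total derivative \<open>\<partial>\<close>.\<close>

definition tot :: "ahat \<Rightarrow> ahat" where
  "tot f = fsum (\<lambda>s. uvar (Suc s) * du s f + theta (Suc s) * dtheta s f)"

definition D1 :: "ahat \<Rightarrow> ahat" where
  "D1 f = fsum (\<lambda>s. theta (Suc s) * du s f)"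

definition D2u :: ahat where
  "D2u = uvar 0 * theta 1 + (1/2) *\<^sub>R (uvar 1 * theta 0)"

definition D2theta :: ahat where
  "D2theta = (1/2) *\<^sub>R (theta 0 * theta 1)"

definition D2 :: "ahat \<Rightarrow> ahat" where
  "D2 f = fsum (\<lambda>s. (tot ^^ s) D2u * du s f + (tot ^^ s) D2theta * dtheta s f)"

lemma mdeg_split:
  assumes "b \<subseteq># a" "T \<subseteq> S" "finite S"
  shows "mdeg a S = mdeg b T + mdeg (a - b) (S - T)"
proof -
  have "sum_mset a = sum_mset b + sum_mset (a - b)"
    using sum_mset.union[of b "a - b"] unfolding subset_mset.add_diff_inverse[OF assms(1)] .
  moreover have "\<Sum>S = \<Sum>T + \<Sum>(S - T)"
    using sum.subset_diff[OF assms(2,3), of "\<lambda>x. x"] by linarith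
  ultimately show ?thesis unfolding mdeg_def by linarith
qed

lemma coeff_times_nonzero:
  assumes "coeff (f * g) a S \<noteq> 0"
  obtains b T where "b \<subseteq># a" "T \<subseteq> S" "finite S" "coeff f b T \<noteq> 0" "coeff g (a - b) (S - T) \<noteq> 0"
proof -
  have fin: "finite S" using coeff_eq_0[of a S "f * g"] assms by auto
  from assms obtain x where "x \<in> splits a S" and "(case x of (b, T) \<Rightarrow>
      ksign T (S - T) * coeff f b T * coeff g (a - b) (S - T)) \<noteq> 0"
    unfolding times_ahat.rep_eq mulc_def by (rule sum.not_neutral_contains_not_neutral)
  then obtain b T where "b \<subseteq># a" "T \<subseteq> S"
    and nz: "ksign T (S - T) * coeff f b T * coeff g (a - b) (S - T) \<noteq> 0"
    by (cases x) (auto simp: splits_def)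
  moreover have "coeff f b T \<noteq> 0" "coeff g (a - b) (S - T) \<noteq> 0"
    using nz by auto
  ultimately show ?thesis using that fin by blast
qed

lemma acompD: "f \<in> acomp p d \<Longrightarrow> coeff f a S \<noteq> 0 \<Longrightarrow> int (card S) = p \<and> int (mdeg a S) = d"
  by (simp add: acomp_def)

lemma acomp_times:
  assumes "f \<in> acomp p d" "g \<in> acomp q e"
  shows "f * g \<in> acomp (p + q) (d + e)"
  unfolding acomp_def
proof (intro CollectI allI impI)
  fix a S assume "coeff (f * g) a S \<noteq> 0"
  then obtain b T where bT: "b \<subseteq># a" "T \<subseteq> S" "finite S" "coeff f b T \<noteq> 0"
    "coeff g (a - b) (S - T) \<noteq> 0" by (rule coeff_times_nonzero)
  have "card S = card T + card (S - T)"
    using bT by (simp add: card_Diff_subset card_mono finite_subset)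
  then show "int (card S) = p + q \<and> int (mdeg a S) = d + e"
    using assms bT mdeg_split[OF bT(1-3)] by (simp add: acomp_def)
qed

lemma acomp_add:
  assumes "f \<in> acomp p d" "g \<in> acomp p d"
  shows "f + g \<in> acomp p d"
  unfolding acomp_def
proof (intro CollectI allI impI)
  fix a S assume "coeff (f + g) a S \<noteq> 0"
  then have "coeff f a S \<noteq> 0 \<or> coeff g a S \<noteq> 0" by (auto simp: plus_ahat.rep_eq)
  then show "int (card S) = p \<and> int (mdeg a S) = d"
    using acompD[OF assms(1)] acompD[OF assms(2)] by blast
qed

lemma acomp_scaleR: "f \<in> acomp p d \<Longrightarrow> c *\<^sub>R f \<in> acomp p d"
  unfolding acomp_def by (auto simp: scaleR_ahat.rep_eq)

lemma acomp_fsum: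
  assumes "\<And>s. F s \<in> acomp p d"
  shows "fsum F \<in> acomp p d"
  unfolding acomp_def
proof (intro CollectI allI impI)
  fix a S assume "coeff (fsum F) a S \<noteq> 0"
  then obtain s where "coeff (F s) a S \<noteq> 0"
    unfolding fsum.rep_eq by (rule sum.not_neutral_contains_not_neutral)
  then show "int (card S) = p \<and> int (mdeg a S) = d"
    using acompD[OF assms] by blast
qed

lemma acomp_func: "func f \<in> acomp 0 0"
  by (auto simp: acomp_def func.rep_eq monc_def mdeg_def)

lemma acomp_uvar: "uvar s \<in> acomp 0 (int s)"
  by (auto simp: uvar_def acomp_def upos.rep_eq func.rep_eq monc_def mdeg_def)

lemma acomp_theta: "theta s \<in> acomp 1 (int s)"
  by (auto simp: acomp_def theta.rep_eq monc_def mdeg_def)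

lemma acomp_du:
  assumes "f \<in> acomp p d"
  shows "du s f \<in> acomp p (d - int s)"
  unfolding acomp_def
proof (intro CollectI allI impI)
  fix a S assume nz: "coeff (du s f) a S \<noteq> 0"
  show "int (card S) = p \<and> int (mdeg a S) = d - int s"
  proof (cases "s = 0")
    case True
    then have "coeff f a S \<noteq> 0" using nz by (auto simp: du.rep_eq)
    then show ?thesis using acompD[OF assms] True by simp
  next
    case False
    then have "coeff f (add_mset s a) S \<noteq> 0" using nz by (auto simp: du.rep_eq)
    moreover have "mdeg (add_mset s a) S = mdeg a S + s" by (simp add: mdeg_def)
    ultimately show ?thesis using acompD[OF assms] by force
  qed
qed

lemma acomp_dtheta:
  assumes "f \<in> acomp p d"
  shows "dtheta s f \<in> acomp (p - 1) (d - int s)"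
  unfolding acomp_def
proof (intro CollectI allI impI)
  fix a S assume nz: "coeff (dtheta s f) a S \<noteq> 0"
  then have s: "s \<notin> S" and c: "coeff f a (insert s S) \<noteq> 0"
    by (auto simp: dtheta.rep_eq split: if_splits)
  have "finite S" using coeff_eq_0[of a S "dtheta s f"] nz by auto
  then have "card (insert s S) = Suc (card S)" "mdeg a (insert s S) = mdeg a S + s"
    using s by (simp_all add: mdeg_def)
  then show "int (card S) = p - 1 \<and> int (mdeg a S) = d - int s"
    using acompD[OF assms c] by simp
qed

lemma acomp_tot:
  assumes "f \<in> acomp p d"
  shows "tot f \<in> acomp p (d + 1)"
  unfolding tot_def
proof (rule acomp_fsum, rule acomp_add)
  fix s
  show "uvar (Suc s) * du s f \<in> acomp p (d + 1)"
    using acomp_times[OF acomp_uvar[of "Suc s"] acomp_du[OF assms, of s]] by (simp add: add_ac)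
  show "theta (Suc s) * dtheta s f \<in> acomp p (d + 1)"
    using acomp_times[OF acomp_theta[of "Suc s"] acomp_dtheta[OF assms, of s]] by (simp add: add_ac)
qed

lemma acomp_tot_pow: "f \<in> acomp p d \<Longrightarrow> (tot ^^ s) f \<in> acomp p (d + int s)"
  by (induction s) (auto dest: acomp_tot simp: add_ac)

lemma acomp_D2u: "D2u \<in> acomp 1 1"
  unfolding D2u_def
  using acomp_times[OF acomp_uvar[of 0] acomp_theta[of 1]]
    acomp_times[OF acomp_uvar[of 1] acomp_theta[of 0]]
  by (auto intro!: acomp_add acomp_scaleR)

lemma acomp_D2theta: "D2theta \<in> acomp 2 1"
  unfolding D2theta_def
  using acomp_times[OF acomp_theta[of 0] acomp_theta[of 1]] by (auto intro!: acomp_scaleR)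

lemma finite_terms_times:
  assumes "\<And>s. X s \<in> acomp p (int (Suc s))"
  shows "finite {s. coeff (X s * Y s) a S \<noteq> 0}"
proof (rule finite_subset)
  show "{s. coeff (X s * Y s) a S \<noteq> 0} \<subseteq> {..mdeg a S}"
  proof clarsimp
    fix s assume "coeff (X s * Y s) a S \<noteq> 0"
    then obtain b T where bT: "b \<subseteq># a" "T \<subseteq> S" "finite S" "coeff (X s) b T \<noteq> 0"
      by (rule coeff_times_nonzero)
    have "int (mdeg b T) = int (Suc s)" using acompD[OF assms bT(4)] by blast
    then have "mdeg b T = Suc s" by linarith
    then show "s \<le> mdeg a S" using mdeg_split[OF bT(1-3)] by simp
  qed
qed simp

lemma finite_terms_add:
  assumes "finite {s. coeff (F s) a S \<noteq> 0}" "finite {s. coeff (G s) a S \<noteq> 0}"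
  shows "finite {s. coeff (F s + G s) a S \<noteq> 0}"
  by (rule finite_subset[OF _ finite_UnI[OF assms]]) (auto simp: plus_ahat.rep_eq)

lemma finite_terms_tot:
  "finite {s. coeff (uvar (Suc s) * du s f + theta (Suc s) * dtheta s f) a S \<noteq> 0}"
  by (intro finite_terms_add finite_terms_times[OF acomp_uvar] finite_terms_times[OF acomp_theta])

lemma finite_terms_D1: "finite {s. coeff (theta (Suc s) * du s f) a S \<noteq> 0}"
  by (rule finite_terms_times[OF acomp_theta])

lemma finite_terms_D2:
  "finite {s. coeff ((tot ^^ s) D2u * du s f + (tot ^^ s) D2theta * dtheta s f) a S \<noteq> 0}"
proof -
  have *: "1 + int s = int (Suc s)" for s by simp
  show ?thesis
    by (intro finite_terms_add finite_terms_times[OF acomp_tot_pow[OF acomp_D2u, unfolded *]]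
        finite_terms_times[OF acomp_tot_pow[OF acomp_D2theta, unfolded *]])
qed

lemma acomp_D1:
  assumes "f \<in> acomp p d"
  shows "D1 f \<in> acomp (p + 1) (d + 1)"
  unfolding D1_def
proof (rule acomp_fsum)
  fix s
  show "theta (Suc s) * du s f \<in> acomp (p + 1) (d + 1)"
    using acomp_times[OF acomp_theta[of "Suc s"] acomp_du[OF assms, of s]] by (simp add: add_ac)
qed

lemma acomp_D2:
  assumes "f \<in> acomp p d"
  shows "D2 f \<in> acomp (p + 1) (d + 1)"
  unfolding D2_def
proof (rule acomp_fsum, rule acomp_add)
  fix s
  show "(tot ^^ s) D2u * du s f \<in> acomp (p + 1) (d + 1)"
    using acomp_times[OF acomp_tot_pow[OF acomp_D2u] acomp_du[OF assms, of s], of s]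
    by (simp add: add_ac)
  show "(tot ^^ s) D2theta * dtheta s f \<in> acomp (p + 1) (d + 1)"
    using acomp_times[OF acomp_tot_pow[OF acomp_D2theta] acomp_dtheta[OF assms, of s], of s]
    by (simp add: add_ac)
qed

definition bh_cycles :: "int \<Rightarrow> int \<Rightarrow> ahat set" where
  "bh_cycles p d = {f \<in> acomp p d. D1 f = 0 \<and> D2 f = 0}"

definition bh_bounds :: "int \<Rightarrow> int \<Rightarrow> ahat set" where
  "bh_bounds p d = (\<lambda>g. D1 (D2 g)) ` acomp (p - 2) (d - 2)"

definition bh_class :: "int \<Rightarrow> int \<Rightarrow> ahat \<Rightarrow> ahat set" where
  "bh_class p d f = {f + b | b. b \<in> bh_bounds p d}"

text \<open>
  The quotient of \<open>bh_cycles p d\<close> by \<open>bh_bounds p d\<close> as a set of cosets, with the vector space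
  operations that the cosets inherit from \<open>ahat\<close>.
\<close>

definition BH :: "int \<Rightarrow> int \<Rightarrow> ahat set set" where
  "BH p d = bh_class p d ` bh_cycles p d"

definition bh_add :: "ahat set \<Rightarrow> ahat set \<Rightarrow> ahat set" where
  "bh_add X Y = {x + y | x y. x \<in> X \<and> y \<in> Y}"

definition bh_scale :: "int \<Rightarrow> int \<Rightarrow> real \<Rightarrow> ahat set \<Rightarrow> ahat set" where
  "bh_scale p d c X = {c *\<^sub>R x + b | x b. x \<in> X \<and> b \<in> bh_bounds p d}"

text \<open>
  \<open>BH p d\<close> is (represented by) the subspace \<open>V\<close>: \<open>V\<close> consists of cocycles, and mapping an element
  of \<open>V\<close> to its class is an isomorphism of real vector spaces from \<open>V\<close> onto \<open>BH p d\<close>.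
\<close>

definition BH_represented_by :: "int \<Rightarrow> int \<Rightarrow> ahat set \<Rightarrow> bool" where
  "BH_represented_by p d V \<longleftrightarrow>
     subspace V \<and> V \<subseteq> bh_cycles p d \<and>
     bij_betw (bh_class p d) V (BH p d) \<and>
     (\<forall>x\<in>V. \<forall>y\<in>V. bh_class p d (x + y) = bh_add (bh_class p d x) (bh_class p d y)) \<and>
     (\<forall>c. \<forall>x\<in>V. bh_class p d (c *\<^sub>R x) = bh_scale p d c (bh_class p d x))"

end

theory Submission
  imports Defs
begin

text \<open>
  On the cocycles of \<open>D1\<close> the differential \<open>D2\<close> equals \<open>D' = D2 - u D1\<close>, in which \<open>u\<close> itself no longer
  occurs as a coefficient. Its anticommutator with \<open>\<partial>/\<partial>\<theta>\<^sup>1\<close> multiplies a monomial of bidegree \<open>(p, d)\<close> with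
  \<open>q\<close> even factors by \<open>q + (d - p)/2\<close>. For \<open>p < d\<close> this is positive, so a cocycle \<open>x\<close> all of whose monomials
  have at least \<open>q\<close> even factors agrees with \<open>D' y\<close>, where \<open>y\<close> is a multiple of \<open>\<partial>x/\<partial>\<theta>\<^sup>1\<close>, up to terms with
  more than \<open>q\<close> even factors. To the same order \<open>y\<close> is closed for the de Rham differential in the
  \<open>u\<^sup>s\<close> with \<open>s \<ge> 1\<close>, the part of \<open>D1\<close> without \<open>\<partial>/\<partial>u\<close>, so \<open>y\<close> agrees with \<open>D1 z\<close> for some \<open>z\<close>. Then
  \<open>x - D2 (D1 z)\<close> is a cocycle with more even factors, and \<open>q\<close> is bounded by \<open>d\<close>. Hence the
  cohomology vanishes for \<open>p < d\<close>. As \<open>p\<close> distinct odd factors have degree at least \<open>p (p - 1)/2\<close>, only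
  \<open>(0, 0)\<close>, \<open>(1, 0)\<close>, \<open>(1, 1)\<close>, \<open>(2, 1)\<close>, \<open>(2, 2)\<close> and \<open>(3, 3)\<close> remain, where the components have
  rank at most two over the smooth functions.
\<close>

section \<open>Coefficients and parity\<close>

lemma mulc_monc_left:
  assumes "finite S"
  shows "mulc (monc c b T) g a S =
    (if b \<subseteq># a \<and> T \<subseteq> S then ksign T (S - T) * c * g (a - b) (S - T) else 0)"
proof -
  have "mulc (monc c b T) g a S =
      (\<Sum>x \<in> splits a S. if x = (b, T) then ksign T (S - T) * c * g (a - b) (S - T) else 0)"
    unfolding mulc_def by (intro sum.cong refl) (auto simp: monc_def split: if_splits)
  also have "\<dots> = (if b \<subseteq># a \<and> T \<subseteq> S then ksign T (S - T) * c * g (a - b) (S - T) else 0)"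
    by (subst sum.delta[OF finite_splits[OF assms]]) (simp add: splits_def)
  finally show ?thesis .
qed

lemma coeff_infinite: "infinite S \<Longrightarrow> coeff f a S = 0"
  by (rule coeff_eq_0) simp

lemma coeff_zero_mem: "0 \<in># a \<Longrightarrow> coeff f a S = 0"
  by (rule coeff_eq_0) simp

lemmas coeff_simps = zero_ahat.rep_eq plus_ahat.rep_eq minus_ahat.rep_eq uminus_ahat.rep_eq
  scaleR_ahat.rep_eq

lemma coeff_sum: "coeff (sum F I) a S = (\<Sum>i\<in>I. coeff (F i) a S)"
  by (induction I rule: infinite_finite_induct) (simp_all add: coeff_simps)

lemma coeff_func_times: "coeff (func c * f) a S = c * coeff f a S"
  by (cases "finite S") (simp_all add: times_ahat.rep_eq func.rep_eq mulc_monc_left mulc_infinite coeff_infinite)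

lemma coeff_theta_times:
  "coeff (theta j * f) a S =
    (if j \<in> S then (-1) ^ card {i \<in> S. i < j} * coeff f a (S - {j}) else 0)"
proof (cases "finite S")
  case True
  have "{(i, k). i \<in> {j} \<and> k \<in> S - {j} \<and> k < i} = Pair j ` {i \<in> S. i < j}" by auto
  then have "ksign {j} (S - {j}) = (-1) ^ card {i \<in> S. i < j}"
    by (simp add: ksign_def card_image inj_on_def)
  with True show ?thesis
    by (simp add: times_ahat.rep_eq theta.rep_eq mulc_monc_left)
qed (simp add: times_ahat.rep_eq mulc_infinite coeff_infinite)

lemma coeff_upos_times:
  "s \<noteq> 0 \<Longrightarrow> coeff (upos s * f) a S = (if s \<in># a then coeff f (a - {#s#}) S else 0)"
  by (cases "finite S") (simp_all add: times_ahat.rep_eq upos.rep_eq mulc_monc_left mulc_infinite coeff_infinite)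

section \<open>Diagonal operators, parity and the sign rule of the product\<close>

definition diag :: "(nat multiset \<Rightarrow> nat set \<Rightarrow> real) \<Rightarrow> ahat \<Rightarrow> ahat" where
  "diag w f = Ahat (\<lambda>a S. w a S *\<^sub>R coeff f a S)"

text \<open>Rescaling coefficients keeps the support among the monomials, so
  \<open>Ahat_inverse\<close> applies. Instances of \<open>diag\<close> are the parity sign, the
  weights of the two homotopies and the reciprocal of \<open>jet_weight\<close>.\<close>

lemma coeff_diag [simp]: "coeff (diag w f) a S = w a S *\<^sub>R coeff f a S"
  unfolding diag_def by (subst Ahat_inverse) (auto intro: ccontr simp: coeff_infinite coeff_zero_mem)

lemma diag_add: "diag w (f + g) = diag w f + diag w g"
  and diag_diff: "diag w (f - g) = diag w f - diag w g"
  and diag_uminus: "diag w (- f) = - diag w f"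
  and diag_scaleR: "diag w (r *\<^sub>R f) = r *\<^sub>R diag w f"
  and diag_0: "diag w 0 = 0"
  by (rule ahat_eqI; simp add: coeff_simps algebra_simps)+

definition super :: "ahat \<Rightarrow> ahat" where
  "super = diag (\<lambda>a S. (-1) ^ card S)"

lemma super_super [simp]: "super (super f) = f"
  by (rule ahat_eqI) (simp add: super_def)

lemmas super_linear = diag_add[of "\<lambda>a S. (-1) ^ card S", folded super_def]
  diag_diff[of "\<lambda>a S. (-1) ^ card S", folded super_def]
  diag_uminus[of "\<lambda>a S. (-1) ^ card S", folded super_def]
  diag_scaleR[of "\<lambda>a S. (-1) ^ card S", folded super_def]
  diag_0[of "\<lambda>a S. (-1) ^ card S", folded super_def]

lemma super_times: "super (f * g) = super f * super g"
proof (rule ahat_eqI)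
  fix a S
  show "coeff (super (f * g)) a S = coeff (super f * super g) a S"
  proof (cases "finite S")
    case True
    have "card T + card (S - T) = card S" if "T \<subseteq> S" for T
      using that True by (simp add: card_Diff_subset card_mono finite_subset)
    then have "(-1 :: real) ^ card T * (-1) ^ card (S - T) = (-1) ^ card S" if "T \<subseteq> S" for T
      using that by (simp flip: power_add)
    then show ?thesis
      by (auto simp: super_def times_ahat.rep_eq mulc_def scaleR_sum_right splits_def mult.commute
          intro!: sum.cong)
  qed (simp add: coeff_infinite)
qed

text \<open>The Koszul sign for moving something of parity \<open>e\<close> past \<open>f\<close>.
  As an operator on \<open>f\<close> it makes product rules meaningful for \<open>f\<close> of mixed
  parity.\<close>

definition twist :: "bool \<Rightarrow> ahat \<Rightarrow> ahat" where
  "twist e f = (if e then super f else f)"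

text \<open>Zero has both parities, so vanishing coefficients of a vector field are covered.\<close>

definition has_parity :: "bool \<Rightarrow> ahat \<Rightarrow> bool" where
  "has_parity e f \<longleftrightarrow> super f = (if e then - f else f)"

lemma has_parityD:
  assumes "has_parity e f" "coeff f a S \<noteq> 0"
  shows "odd (card S) \<longleftrightarrow> e"
proof -
  have "coeff (super f) a S = coeff (if e then - f else f) a S"
    using assms(1) by (simp add: has_parity_def)
  then have "(-1) ^ card S *\<^sub>R coeff f a S = (if e then -1 else 1::real) *\<^sub>R coeff f a S"
    by (auto simp: super_def coeff_simps split: if_splits)
  then have "(-1) ^ card S = (if e then -1 else 1::real)"
    using assms(2) by (simp add: scaleR_right_imp_eq del: scaleR_minus_left)
  then show ?thesis by (auto split: if_splits simp: minus_one_power_iff)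
qed

lemma has_parityI:
  assumes "\<And>a S. coeff f a S \<noteq> 0 \<Longrightarrow> odd (card S) \<longleftrightarrow> e"
  shows "has_parity e f"
  unfolding has_parity_def
proof (rule ahat_eqI)
  fix a S
  show "coeff (super f) a S = coeff (if e then - f else f) a S"
    using assms[of a S] by (cases "coeff f a S = 0") (auto simp: super_def coeff_simps)
qed

text \<open>Every pair in \<open>T \<times> R\<close> is an inversion for exactly one of the two
  orders, so the two inversion counts add up to \<open>card T * card R\<close>.\<close>

lemma ksign_swap:
  assumes "finite T" "finite R" "T \<inter> R = {}"
  shows "ksign T R = (-1) ^ (card T * card R) * ksign R T"
proof -
  let ?A = "{(i, j). i \<in> T \<and> j \<in> R \<and> j < i}"
  let ?B = "{(i, j). i \<in> R \<and> j \<in> T \<and> j < i}"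
  have 1: "card ?B = card {(i, j). i \<in> T \<and> j \<in> R \<and> i < j}"
    by (rule bij_betw_same_card[where f = prod.swap]) (auto simp: bij_betw_def inj_on_def image_def)
  have 2: "?A \<union> {(i, j). i \<in> T \<and> j \<in> R \<and> i < j} = T \<times> R"
    using assms(3) by (auto simp: set_eq_iff) (metis linorder_neqE_nat)
  have 3: "?A \<inter> {(i, j). i \<in> T \<and> j \<in> R \<and> i < j} = {}" by auto
  have 4: "finite {(i, j). i \<in> T \<and> j \<in> R \<and> i < j}"
    by (rule finite_subset[of _ "T \<times> R"]) (use assms in auto)
  have "card T * card R = card ?A + card ?B"
    unfolding 1 card_Un_disjoint[OF finite_inversions[OF assms(1,2)] 4 3, symmetric] 2
    by (simp add: card_cartesian_product)
  then have "(-1 :: cinf) ^ (card T * card R) * (-1) ^ card ?B = (-1) ^ card ?A"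
    by (simp add: power_add mult.assoc)
  then show ?thesis by (simp add: ksign_def)
qed

lemma mset_double_diff: "b \<subseteq># a \<Longrightarrow> a - (a - b) = b"
  by (rule multiset_eqI) (simp add: mset_subset_eq_count)

text \<open>Passing to complements, \<open>(b, T)\<close> to \<open>(a - b, S - T)\<close>, matches
  the two products term by term. Where \<open>g\<close> has a nonzero coefficient,
  \<open>card T\<close> has parity \<open>e\<close>, so the sign from \<open>ksign_swap\<close>
  depends only on the factor from \<open>f\<close>; this sign is what \<open>twist e\<close>
  records.\<close>

lemma supercommute:
  assumes "has_parity e g"
  shows "g * f = twist e f * g"
proof (rule ahat_eqI)
  fix a S
  show "coeff (g * f) a S = coeff (twist e f * g) a S"
  proof (cases "finite S")
    case True
    show ?thesis
      unfolding times_ahat.rep_eq mulc_def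
    proof (rule sum.reindex_bij_witness[of _ "\<lambda>(b, T). (a - b, S - T)" "\<lambda>(b, T). (a - b, S - T)"],
        goal_cases)
      case (5 x)
      obtain b T where x: "x = (b, T)" by (cases x)
      have s: "b \<subseteq># a" "T \<subseteq> S" using 5 x by (auto simp: splits_def)
      have f: "finite T" "finite (S - T)" using True s by (auto intro: finite_subset)
      have e1: "a - (a - b) = b" using s(1) by (rule mset_double_diff)
      have e2: "S - (S - T) = T" using s by auto
      show ?case
      proof (cases "coeff g b T = 0")
        case False
        then have par: "odd (card T) \<longleftrightarrow> e" by (rule has_parityD[OF assms])
        have "ksign T (S - T) = (-1) ^ (card T * card (S - T)) * ksign (S - T) T"
          by (rule ksign_swap) (use f in auto)
        moreover have "(-1) ^ (card T * card (S - T)) * coeff f (a - b) (S - T) = coeff (twist e f) (a - b) (S - T)"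
          using par by (auto simp: twist_def super_def minus_one_power_iff)
        ultimately show ?thesis unfolding x using e1 e2 by (simp add: mult_ac)
      qed (simp add: x e1 e2)
    qed (auto simp: splits_def mset_double_diff double_diff)
  qed (simp add: coeff_infinite)
qed

section \<open>Polynomial elements\<close>

text \<open>The series of bounded standard degree. They include every \<open>acomp p d\<close> and
  are finite sums of monomials, so the infinite sums defining the operators become finite on each of
  them and identities can be proved by induction over generators.\<close>

definition polys :: "ahat set" where
  "polys = {f. \<exists>n. \<forall>a S. coeff f a S \<noteq> 0 \<longrightarrow> mdeg a S \<le> n}"

lemma acomp_polys:
  assumes "f \<in> acomp p d"
  shows "f \<in> polys"
proof -
  have "mdeg a S \<le> nat d" if "coeff f a S \<noteq> 0" for a S
    using acompD[OF assms that] by linarith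
  then show ?thesis unfolding polys_def by blast
qed

lemma polys_add [intro]:
  assumes "f \<in> polys" "g \<in> polys"
  shows "f + g \<in> polys"
proof -
  obtain m n where "\<And>a S. coeff f a S \<noteq> 0 \<Longrightarrow> mdeg a S \<le> m" "\<And>a S. coeff g a S \<noteq> 0 \<Longrightarrow> mdeg a S \<le> n"
    using assms unfolding polys_def by blast
  then have "coeff (f + g) a S \<noteq> 0 \<Longrightarrow> mdeg a S \<le> max m n" for a S
    by (force simp: coeff_simps max_def)
  then show ?thesis unfolding polys_def by blast
qed

lemma polys_times [intro]:
  assumes "f \<in> polys" "g \<in> polys"
  shows "f * g \<in> polys"
proof -
  obtain m n where mn: "\<And>a S. coeff f a S \<noteq> 0 \<Longrightarrow> mdeg a S \<le> m" "\<And>a S. coeff g a S \<noteq> 0 \<Longrightarrow> mdeg a S \<le> n"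
    using assms unfolding polys_def by blast
  have "mdeg a S \<le> m + n" if "coeff (f * g) a S \<noteq> 0" for a S
    using that by (rule coeff_times_nonzero) (use mn mdeg_split add_mono in metis)
  then show ?thesis unfolding polys_def by blast
qed

lemma polys_diag [intro]: "f \<in> polys \<Longrightarrow> diag w f \<in> polys"
  unfolding polys_def by auto

lemma polys_scaleR [intro]: "f \<in> polys \<Longrightarrow> r *\<^sub>R f \<in> polys"
  unfolding polys_def by (auto simp: coeff_simps)

lemma polys_0 [intro]: "0 \<in> polys"
  unfolding polys_def by (auto simp: coeff_simps)

lemma polys_diff [intro]: "f \<in> polys \<Longrightarrow> g \<in> polys \<Longrightarrow> f - g \<in> polys"
  using polys_add[of f "(-1) *\<^sub>R g"] polys_scaleR[of g "-1"] by simp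

lemma polys_uminus [intro]: "f \<in> polys \<Longrightarrow> - f \<in> polys"
  using polys_scaleR[of f "-1"] by auto

lemma polys_super [intro]: "f \<in> polys \<Longrightarrow> super f \<in> polys"
  unfolding super_def by auto

lemma polys_sum [intro]: "(\<And>i. i \<in> I \<Longrightarrow> F i \<in> polys) \<Longrightarrow> sum F I \<in> polys"
  by (induction I rule: infinite_finite_induct) auto

lemma acomp_upos: "upos s \<in> acomp 0 (int s)"
  by (auto simp: acomp_def upos.rep_eq monc_def mdeg_def)

lemma polys_gens [intro]: "func c \<in> polys" "theta s \<in> polys" "upos s \<in> polys" "uvar s \<in> polys"
  by (rule acomp_polys, rule acomp_func acomp_theta acomp_upos acomp_uvar)+

text \<open>Even factors have positive degree, so the degree bounds their number as well as all
  indices. The multiset \<open>?top\<close> with \<open>n\<close> copies of each index therefore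
  contains every \<open>a\<close> in question.\<close>

lemma finite_mdeg_le: "finite {(a, S). 0 \<notin># a \<and> finite S \<and> mdeg a S \<le> n}"
proof -
  have size: "size a \<le> sum_mset a" if "0 \<notin># a" for a :: "nat multiset"
    using that by (induction a) auto
  let ?top = "\<Sum>i\<le>n. replicate_mset n i"
  have a: "a \<subseteq># ?top" if "0 \<notin># a" "sum_mset a \<le> n" for a
  proof (rule mset_subset_eqI)
    fix s
    show "count a s \<le> count ?top s"
    proof (cases "s \<in># a")
      case True
      then obtain b where b: "a = add_mset s b" by (metis insert_DiffM)
      have "s \<le> n" using that b by simp
      then have "count ?top s = n" by (simp add: count_sum)
      moreover have "count a s \<le> n"
        using count_le_size[of a s] size[of a] that by linarith
      ultimately show ?thesis by simp
    qed (simp add: not_in_iff)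
  qed
  have S: "S \<subseteq> {..n}" if "finite S" "\<Sum>S \<le> n" for S
    using that member_le_sum[of _ S "\<lambda>x. x"] by fastforce
  have "a \<subseteq># ?top \<and> S \<subseteq> {..n}" if "0 \<notin># a" "finite S" "mdeg a S \<le> n" for a S
    using that a[of a] S[of S] by (simp add: mdeg_def)
  then have "{(a, S). 0 \<notin># a \<and> finite S \<and> mdeg a S \<le> n} \<subseteq> {a. a \<subseteq># ?top} \<times> Pow {..n}"
    by blast
  then show ?thesis
    by (rule finite_subset) (simp add: finite_submultisets)
qed

lift_definition monomial :: "cinf \<Rightarrow> nat multiset \<Rightarrow> nat set \<Rightarrow> ahat" is
  "\<lambda>c a S. if 0 \<in># a \<or> infinite S then (\<lambda>_ _. 0) else monc c a S"
  by (auto simp: monc_def split: if_splits)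

lemma coeff_monomial:
  "0 \<notin># a \<Longrightarrow> finite S \<Longrightarrow> coeff (monomial c a S) b T = (if b = a \<and> T = S then c else 0)"
  by (simp add: monomial.rep_eq monc_def)

lemma monomial_empty: "monomial c {#} {} = func c"
  by transfer simp

text \<open>The new factor has the smallest index, so it stands in front of the ordered product
  without a sign.\<close>

lemma monomial_theta:
  assumes "finite S" "\<And>i. i \<in> S \<Longrightarrow> j < i"
  shows "monomial c {#} (insert j S) = theta j * monomial c {#} S"
proof (rule ahat_eqI)
  fix b T
  have j: "j \<notin> S" using assms(2) by blast
  have e: "{i \<in> insert j S. i < j} = {}" using assms(2) by fastforce
  show "coeff (monomial c {#} (insert j S)) b T = coeff (theta j * monomial c {#} S) b T"
  proof (cases "T = insert j S")
    case True
    have "insert j S - {j} = S" using j by simp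
    then show ?thesis
      unfolding True coeff_theta_times e using assms(1) by (simp add: coeff_monomial)
  next
    case False
    then have "j \<in> T \<Longrightarrow> T - {j} \<noteq> S" by auto
    then show ?thesis using False assms(1) by (simp add: coeff_theta_times coeff_monomial)
  qed
qed

lemma monomial_upos:
  assumes "finite S" "0 \<notin># a" "s \<noteq> 0"
  shows "monomial c (add_mset s a) S = upos s * monomial c a S"
proof (rule ahat_eqI)
  fix b T
  have "s \<in># b \<Longrightarrow> b - {#s#} = a \<longleftrightarrow> b = add_mset s a"
    by (auto dest!: multi_member_split)
  then show "coeff (monomial c (add_mset s a) S) b T = coeff (upos s * monomial c a S) b T"
    using assms by (simp add: coeff_upos_times coeff_monomial)
qed

lemma monomial_expansion:
  assumes I: "finite I" "\<And>a S. (a, S) \<in> I \<Longrightarrow> 0 \<notin># a \<and> finite S"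
    and f: "\<And>a S. coeff f a S \<noteq> 0 \<Longrightarrow> (a, S) \<in> I"
  shows "\<exists>c. f = (\<Sum>(a, S)\<in>I. monomial (c a S) a S)"
proof (intro exI ahat_eqI)
  fix b T
  have "coeff (\<Sum>(a, S)\<in>I. monomial (coeff f a S) a S) b T = (\<Sum>x\<in>I. if x = (b, T) then coeff f b T else 0)"
    unfolding coeff_sum using I(2) by (intro sum.cong) (auto simp: coeff_monomial split: if_splits)
  also have "\<dots> = coeff f b T"
    using I(1) f[of b T] by (auto simp: sum.delta)
  finally show "coeff f b T = coeff (\<Sum>(a, S)\<in>I. monomial (coeff f a S) a S) b T" ..
qed

text \<open>Each monomial arises from a function by left multiplications: first by odd generators in
  decreasing order of index, so that no signs occur, then by even ones. Membership in
  \<open>polys\<close> is carried along because the product rules ask for it.\<close>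

lemma polys_induct [consumes 1, case_names zero add func theta upos]:
  assumes f: "f \<in> polys"
    and P0: "P 0"
    and Padd: "\<And>f g. f \<in> polys \<Longrightarrow> g \<in> polys \<Longrightarrow> P f \<Longrightarrow> P g \<Longrightarrow> P (f + g)"
    and Pfunc: "\<And>c. P (func c)"
    and Ptheta: "\<And>j f. f \<in> polys \<Longrightarrow> P f \<Longrightarrow> P (theta j * f)"
    and Pupos: "\<And>s f. s \<noteq> 0 \<Longrightarrow> f \<in> polys \<Longrightarrow> P f \<Longrightarrow> P (upos s * f)"
  shows "P f"
proof -
  have th: "monomial c {#} S \<in> polys \<and> P (monomial c {#} S)" if "finite S" for c S
    using that
  proof (induction S rule: finite_linorder_min_induct)
    case (insert j S)
    then show ?case using monomial_theta[of S j c] by (auto intro: Ptheta)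
  qed (auto simp: monomial_empty intro: Pfunc)
  have m: "monomial c a S \<in> polys \<and> P (monomial c a S)" if "finite S" "0 \<notin># a" for c a S
    using that(2)
  proof (induction a)
    case (add s a)
    then show ?case using monomial_upos[OF that(1), of a s c] by (auto intro: Pupos)
  qed (simp add: th that)
  obtain n where n: "\<And>a S. coeff f a S \<noteq> 0 \<Longrightarrow> mdeg a S \<le> n"
    using f unfolding polys_def by blast
  define I where "I = {(a, S). 0 \<notin># a \<and> finite S \<and> mdeg a S \<le> n}"
  have I: "finite I" unfolding I_def by (rule finite_mdeg_le)
  have "\<exists>c. f = (\<Sum>(a, S)\<in>I. monomial (c a S) a S)"
  proof (rule monomial_expansion[OF I])
    show "(a, S) \<in> I" if "coeff f a S \<noteq> 0" for a S
      using n[OF that] that coeff_eq_0[of a S f] by (auto simp: I_def)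
  qed (auto simp: I_def)
  then obtain c where f: "f = (\<Sum>(a, S)\<in>I. monomial (c a S) a S)" ..
  have "(\<Sum>(a, S)\<in>J. monomial (c a S) a S) \<in> polys \<and> P (\<Sum>(a, S)\<in>J. monomial (c a S) a S)"
    if "J \<subseteq> I" for J
    using finite_subset[OF that I] that
  proof (induction J rule: finite_induct)
    case (insert x J)
    then have "finite (snd x)" "0 \<notin># fst x" by (auto simp: I_def split_def)
    then show ?case using insert m by (auto simp: split_def intro: Padd)
  qed (auto simp: P0)
  then show ?thesis using f by blast
qed

section \<open>Partial derivatives of products with one generator\<close>

lemma cderiv_add: "cderiv (x + y) = cderiv x + cderiv y"
  by transfer (auto simp: fun_eq_iff smooth_field_differentiable intro!: deriv_add)

lemma du_add: "du s (f + g) = du s f + du s g"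
  by (rule ahat_eqI) (simp add: du.rep_eq coeff_simps cderiv_add algebra_simps)

lemma cderiv_mult: "cderiv (x * y) = cderiv x * y + x * cderiv y"
  by transfer (auto simp: fun_eq_iff smooth_field_differentiable intro!: ext)

lemma cderiv_const: "cderiv (r *\<^sub>R 1) = 0"
  by transfer (auto simp: fun_eq_iff)

lemma cderiv_scaleR: "cderiv (r *\<^sub>R x) = r *\<^sub>R cderiv x"
  using cderiv_mult[of "r *\<^sub>R 1" x] by (simp add: cderiv_const)

lemma cderiv_sign: "cderiv ((-1) ^ n * x) = (-1) ^ n * cderiv x"
  using cderiv_scaleR[of "-1" x] by (cases "even n") simp_all

lemma du_scaleR: "du s (r *\<^sub>R f) = r *\<^sub>R du s f"
  by (rule ahat_eqI) (simp add: du.rep_eq coeff_simps cderiv_scaleR)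

lemma dtheta_add: "dtheta s (f + g) = dtheta s f + dtheta s g"
  by (rule ahat_eqI) (simp add: dtheta.rep_eq coeff_simps algebra_simps)

lemma dtheta_scaleR: "dtheta s (r *\<^sub>R f) = r *\<^sub>R dtheta s f"
  by (rule ahat_eqI) (simp add: dtheta.rep_eq coeff_simps)

lemma du_0 [simp]: "du s 0 = 0" using du_scaleR[of s 0] by simp
lemma dtheta_0 [simp]: "dtheta s 0 = 0" using dtheta_scaleR[of s 0] by simp

lemma du_func_times: "du s (func c * f) = (if s = 0 then func (cderiv c) * f else 0) + func c * du s f"
  by (rule ahat_eqI) (simp add: du.rep_eq coeff_func_times coeff_simps cderiv_mult algebra_simps)

lemma du_theta_times: "du s (theta j * f) = theta j * du s f"
  by (rule ahat_eqI) (simp add: du.rep_eq coeff_theta_times cderiv_sign mult.left_commute)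

lemma du_upos_times:
  assumes "j \<noteq> 0"
  shows "du s (upos j * f) = (if s = j then f else 0) + upos j * du s f"
proof (rule ahat_eqI)
  fix a S
  show "coeff (du s (upos j * f)) a S = coeff ((if s = j then f else 0) + upos j * du s f) a S"
  proof (cases "s = j")
    case True
    have "coeff f (add_mset j (a - {#j#})) S = coeff f a S" if "j \<in># a" using that by simp
    then show ?thesis
      using assms True
      by (auto simp: du.rep_eq coeff_upos_times coeff_simps algebra_simps not_in_iff of_nat_diff
        simp flip: of_nat_add split: nat_diff_split)
  next
    case False
    have "add_mset s (a - {#j#}) = add_mset s a - {#j#}" if "j \<in># a"
      using that False by (simp add: diff_add_mset_swap)
    then show ?thesis
      using assms False by (auto simp: du.rep_eq coeff_upos_times coeff_simps)
  qed
qed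

lemma dtheta_func_times: "dtheta s (func c * f) = func c * dtheta s f"
  by (rule ahat_eqI) (simp add: dtheta.rep_eq coeff_func_times)

lemma dtheta_upos_times: "j \<noteq> 0 \<Longrightarrow> dtheta s (upos j * f) = upos j * dtheta s f"
  by (rule ahat_eqI) (simp add: dtheta.rep_eq coeff_upos_times)

lemma dtheta_theta_times: "dtheta s (theta j * f) = (if s = j then f else 0) - theta j * dtheta s f"
proof (rule ahat_eqI)
  fix a S
  show "coeff (dtheta s (theta j * f)) a S = coeff ((if s = j then f else 0) - theta j * dtheta s f) a S"
  proof (cases "finite S")
    case fin: True
    show ?thesis
    proof (cases "s = j")
      case True
      have [simp]: "{i. (i = j \<or> i \<in> S) \<and> i < j} = {i \<in> S. i < j}" "{i \<in> S. i \<noteq> j \<and> i < j} = {i \<in> S. i < j}"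
        by auto
      show ?thesis using True
        by (auto simp: dtheta.rep_eq coeff_theta_times coeff_simps insert_absorb)
    next
      case False
      have eq: "insert s S - {j} = insert s (S - {j})" using False by auto
      have c1: "card {i \<in> insert s S. i < j} = (if s < j \<and> s \<notin> S then 1 else 0) + card {i \<in> S. i < j}"
      proof -
        have "{i \<in> insert s S. i < j} = (if s < j then insert s {i \<in> S. i < j} else {i \<in> S. i < j})" by auto
        then show ?thesis using fin by (auto simp: insert_absorb)
      qed
      have c2: "card {i \<in> S. i < s} = (if j < s \<and> j \<in> S then 1 else 0) + card {i \<in> S - {j}. i < s}"
      proof -
        have "{i \<in> S. i < s} = (if j < s \<and> j \<in> S then insert j {i \<in> S - {j}. i < s} else {i \<in> S - {j}. i < s})" by auto
        also have "card \<dots> = (if j < s \<and> j \<in> S then 1 else 0) + card {i \<in> S - {j}. i < s}"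
          using fin by simp
        finally show ?thesis .
      qed
      \<comment> \<open>Either inserting \<open>s\<close> adds an index below \<open>j\<close>, or
        removing \<open>j\<close> takes away one below \<open>s\<close>, never both. This is the
        minus sign of the odd product rule. \<open>m\<close> and \<open>n\<close> stand for the
        remaining cardinalities.\<close>
      have sign: "(if s \<in> S then 0 else (-1) ^ ((if j < s \<and> j \<in> S then 1 else 0) + m) *
            (if j \<in> insert s S then (-1) ^ ((if s < j \<and> s \<notin> S then 1 else 0) + n) * y else 0)) =
          0 - (if j \<in> S then (-1) ^ n * (if s \<in> S - {j} then 0 else (-1) ^ m * y) else 0)"
        for m n and y :: cinf
        using False by (cases s j rule: linorder_cases) (simp_all add: mult.left_commute)
      show ?thesis
        unfolding coeff_simps dtheta.rep_eq coeff_theta_times c1 c2 eq sign if_not_P[OF False] ..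
    qed
  qed (simp add: coeff_infinite)
qed

section \<open>Derivations\<close>

lemma polys_du [intro]:
  assumes "f \<in> polys"
  shows "du s f \<in> polys"
proof -
  obtain n where n: "\<And>a S. coeff f a S \<noteq> 0 \<Longrightarrow> mdeg a S \<le> n"
    using assms unfolding polys_def by blast
  have "mdeg a S \<le> n" if "coeff (du s f) a S \<noteq> 0" for a S
  proof (cases "s = 0")
    case True
    then have "coeff f a S \<noteq> 0" using that by (auto simp: du.rep_eq)
    then show ?thesis by (rule n)
  next
    case False
    then have "coeff f (add_mset s a) S \<noteq> 0" using that by (auto simp: du.rep_eq)
    from n[OF this] show ?thesis by (simp add: mdeg_def)
  qed
  then show ?thesis unfolding polys_def by blast
qed

lemma polys_dtheta [intro]:
  assumes "f \<in> polys"
  shows "dtheta s f \<in> polys"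
proof -
  obtain n where n: "\<And>a S. coeff f a S \<noteq> 0 \<Longrightarrow> mdeg a S \<le> n"
    using assms unfolding polys_def by blast
  have "mdeg a S \<le> n" if "coeff (dtheta s f) a S \<noteq> 0" for a S
  proof -
    have "s \<notin> S" "coeff f a (insert s S) \<noteq> 0" "finite S"
      using that coeff_infinite[of S "dtheta s f"] by (auto simp: dtheta.rep_eq split: if_splits)
    with n[OF this(2)] show ?thesis by (simp add: mdeg_def)
  qed
  then show ?thesis unfolding polys_def by blast
qed

lemma polys_finitely_many_vars:
  assumes "f \<in> polys"
  shows "\<exists>n. \<forall>s>n. du s f = 0 \<and> dtheta s f = 0"
proof -
  obtain n where n: "\<And>a S. coeff f a S \<noteq> 0 \<Longrightarrow> mdeg a S \<le> n"
    using assms unfolding polys_def by blast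
  have "du s f = 0 \<and> dtheta s f = 0" if "s > n" for s
  proof (intro conjI ahat_eqI)
    fix a S
    have "mdeg (add_mset s a) S > n" using that by (simp add: mdeg_def)
    then have "coeff f (add_mset s a) S = 0" using n not_le by blast
    then show "coeff (du s f) a S = coeff 0 a S"
      using that by (simp add: du.rep_eq coeff_simps)
    have "mdeg a (insert s S) > n" if "finite S"
      using that \<open>s > n\<close> member_le_sum[of s "insert s S" "\<lambda>x. x"] by (simp add: mdeg_def)
    then have "finite S \<Longrightarrow> coeff f a (insert s S) = 0"
      using n not_le by blast
    then show "coeff (dtheta s f) a S = coeff 0 a S"
      using coeff_infinite[of S "dtheta s f"]
      by (cases "finite S") (auto simp: dtheta.rep_eq coeff_simps)
  qed
  then show ?thesis by blast
qed

text \<open>\<open>A s\<close> and \<open>B s\<close> are the values on \<open>u^s\<close> and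
  \<open>theta s\<close>. The operators \<open>tot\<close>, \<open>D1\<close>, \<open>D2\<close> and
  the auxiliary differentials and contraction below all have this form.\<close>

definition vfield :: "(nat \<Rightarrow> ahat) \<Rightarrow> (nat \<Rightarrow> ahat) \<Rightarrow> ahat \<Rightarrow> ahat" where
  "vfield A B f = fsum (\<lambda>s. A s * du s f + B s * dtheta s f)"

lemma fsum_finite:
  assumes "\<And>s. s > n \<Longrightarrow> F s = 0"
  shows "fsum F = (\<Sum>s\<le>n. F s)"
proof (rule ahat_eqI)
  fix a S
  have "{s. coeff (F s) a S \<noteq> 0} \<subseteq> {..n}"
    using assms by (force simp: coeff_simps not_less[symmetric])
  then show "coeff (fsum F) a S = coeff (\<Sum>s\<le>n. F s) a S"
    unfolding fsum.rep_eq coeff_sum by (intro sum.mono_neutral_left) auto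
qed

lemma vfield_sum:
  assumes "\<And>s. s > n \<Longrightarrow> du s f = 0 \<and> dtheta s f = 0"
  shows "vfield A B f = (\<Sum>s\<le>n. A s * du s f + B s * dtheta s f)"
  unfolding vfield_def by (rule fsum_finite) (simp add: assms)

lemma polys_common_vars:
  assumes "f \<in> polys" "g \<in> polys"
  shows "\<exists>n. \<forall>s>n. (du s f = 0 \<and> dtheta s f = 0) \<and> du s g = 0 \<and> dtheta s g = 0"
proof -
  obtain m n where "\<forall>s>m. du s f = 0 \<and> dtheta s f = 0" "\<forall>s>n. du s g = 0 \<and> dtheta s g = 0"
    using polys_finitely_many_vars assms by meson
  then show ?thesis by (intro exI[of _ "max m n"]) simp
qed

lemma parity_theta: "has_parity True (theta s)"
  by (rule has_parityI) (auto simp: theta.rep_eq monc_def split: if_splits)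

lemma super_theta: "super (theta s) = - theta s"
  using parity_theta by (simp add: has_parity_def)

lemma super_func: "super (func c) = func c"
  by (rule ahat_eqI) (simp add: super_def func.rep_eq monc_def)

lemma super_upos: "super (upos s) = upos s"
  by (rule ahat_eqI) (simp add: super_def upos.rep_eq monc_def)

lemma func_commute: "func c * f = f * func c"
  using supercommute[of False "func c" f] by (simp add: has_parity_def super_func twist_def)

lemma upos_commute: "upos s * f = f * upos s"
  using supercommute[of False "upos s" f] by (simp add: has_parity_def super_upos twist_def)

lemma theta_commute: "theta j * f = super f * theta j"
  using supercommute[OF parity_theta, of j f] by (simp add: twist_def)

lemma du_times:
  assumes "f \<in> polys"
  shows "du s (f * g) = du s f * g + f * du s g"
  using assms
proof (induction f rule: polys_induct)
  case (func c)
  have "du s (func c) = (if s = 0 then func (cderiv c) else 0)"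
    by (rule ahat_eqI) (auto simp: du.rep_eq func.rep_eq monc_def coeff_simps)
  then show ?case by (simp add: du_func_times)
qed (simp_all add: distrib_right du_add du_theta_times du_upos_times distrib_left mult.assoc)

lemma dtheta_times:
  assumes "f \<in> polys"
  shows "dtheta s (f * g) = dtheta s f * g + super f * dtheta s g"
  using assms
proof (induction f rule: polys_induct)
  case (func c)
  have "dtheta s (func c) = 0"
    by (rule ahat_eqI) (auto simp: dtheta.rep_eq func.rep_eq monc_def coeff_simps)
  then show ?case by (simp add: dtheta_func_times super_func)
qed (simp_all add: distrib_right dtheta_add dtheta_theta_times dtheta_upos_times distrib_left mult.assoc
    super_linear super_times super_theta super_upos left_diff_distrib right_diff_distrib)

lemma super_du: "super (du s f) = du s (super f)"
  by (rule ahat_eqI) (simp add: super_def du.rep_eq cderiv_scaleR)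

lemma super_dtheta: "super (dtheta s f) = - dtheta s (super f)"
proof (rule ahat_eqI)
  fix a S
  show "coeff (super (dtheta s f)) a S = coeff (- dtheta s (super f)) a S"
    by (cases "finite S") (simp_all add: super_def dtheta.rep_eq coeff_simps coeff_infinite)
qed

text \<open>Superderivations, odd for \<open>e = True\<close>. Preservation of \<open>polys\<close>
  and compatibility with \<open>super\<close> are included so that the class is closed under
  supercommutators.\<close>

definition deriv_on_polys :: "bool \<Rightarrow> (ahat \<Rightarrow> ahat) \<Rightarrow> bool" where
  "deriv_on_polys e X \<longleftrightarrow> (\<forall>f\<in>polys. X f \<in> polys \<and> super (X f) = (if e then - X (super f) else X (super f)) \<and>
     (\<forall>r. X (r *\<^sub>R f) = r *\<^sub>R X f) \<and>
     (\<forall>g\<in>polys. X (f + g) = X f + X g \<and> X (f * g) = X f * g + twist e f * X g))"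

lemma derivD:
  assumes "deriv_on_polys e X" "f \<in> polys"
  shows "X f \<in> polys" "super (X f) = (if e then - X (super f) else X (super f))"
    "X (r *\<^sub>R f) = r *\<^sub>R X f"
    "g \<in> polys \<Longrightarrow> X (f + g) = X f + X g" "g \<in> polys \<Longrightarrow> X (f * g) = X f * g + twist e f * X g"
  using assms unfolding deriv_on_polys_def by blast+

lemma deriv_minus:
  assumes "deriv_on_polys e X" "f \<in> polys"
  shows "X (- f) = - X f"
  using derivD(3)[OF assms, of "-1"] by simp

lemma deriv_diff:
  assumes "deriv_on_polys e X" "f \<in> polys" "g \<in> polys"
  shows "X (f - g) = X f - X g"
  using derivD(4)[OF assms(1,2), of "- g"] deriv_minus[OF assms(1,3)] assms(3) by auto

lemma deriv_zero:
  assumes "deriv_on_polys e X"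
  shows "X 0 = 0"
  using derivD(3)[OF assms polys_0, of 0] by simp

lemma super_sum: "super (sum F I) = (\<Sum>i\<in>I. super (F i))"
  by (induction I rule: infinite_finite_induct) (simp_all add: super_linear)

text \<open>\<open>A\<close> and \<open>B\<close> have opposite parities because
  \<open>dtheta\<close> is itself odd. Its product rule already contains \<open>super f\<close>, and
  moving \<open>B s\<close> past \<open>super f\<close> costs the same \<open>twist e f\<close> as
  moving \<open>A s\<close> past \<open>f\<close>.\<close>

lemma deriv_vfield:
  assumes A: "\<And>s. has_parity e (A s)" "\<And>s. A s \<in> polys"
    and B: "\<And>s. has_parity (\<not> e) (B s)" "\<And>s. B s \<in> polys"
  shows "deriv_on_polys e (vfield A B)"
  unfolding deriv_on_polys_def
proof (intro ballI conjI allI)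
  fix f assume f: "f \<in> polys"
  have sup: "du s (super f) = super (du s f)" "dtheta s (super f) = - super (dtheta s f)" for s
    by (simp_all only: super_du super_dtheta minus_minus)
  obtain n where n: "\<And>s. s > n \<Longrightarrow> du s f = 0 \<and> dtheta s f = 0"
    using polys_finitely_many_vars[OF f] by meson
  have V: "vfield A B f = (\<Sum>s\<le>n. A s * du s f + B s * dtheta s f)"
    by (rule vfield_sum) (rule n)
  show "vfield A B f \<in> polys"
    unfolding V by (intro polys_sum polys_add polys_times A B polys_du polys_dtheta f)
  have "vfield A B (super f) = (\<Sum>s\<le>n. A s * du s (super f) + B s * dtheta s (super f))"
    by (rule vfield_sum) (simp add: sup n super_linear)
  then show "super (vfield A B f) = (if e then - vfield A B (super f) else vfield A B (super f))"
    using A(1) B(1) unfolding V has_parity_def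
    by (cases e) (simp_all add: super_sum super_linear super_times sup flip: sum_negf)
  show "vfield A B (r *\<^sub>R f) = r *\<^sub>R vfield A B f" for r
    by (subst (1 2) vfield_sum[where n = n]) (simp_all add: n du_scaleR dtheta_scaleR scaleR_sum_right scaleR_add_right)
  fix g assume g: "g \<in> polys"
  obtain n where n: "\<And>s. s > n \<Longrightarrow> du s f = 0 \<and> dtheta s f = 0"
    "\<And>s. s > n \<Longrightarrow> du s g = 0 \<and> dtheta s g = 0"
    using polys_common_vars[OF f g] by meson
  show "vfield A B (f + g) = vfield A B f + vfield A B g"
    by (subst (1 2 3) vfield_sum[where n = n])
      (simp_all add: n du_add dtheta_add distrib_left add_ac sum.distrib)
  have "A s * f = twist e f * A s" for s by (rule supercommute[OF A(1)])
  moreover have "B s * super f = twist e f * B s" for s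
    using supercommute[OF B(1), of s "super f"] by (simp add: twist_def split: if_splits)
  ultimately have "A s * (f * x) = twist e f * (A s * x)" "B s * (super f * x) = twist e f * (B s * x)" for s x
    by (metis mult.assoc)+
  then show "vfield A B (f * g) = vfield A B f * g + twist e f * vfield A B g"
    by (subst (1 2 3) vfield_sum[where n = n])
      (simp_all add: n du_times[OF f] dtheta_times[OF f] distrib_left distrib_right sum_distrib_left
        sum_distrib_right sum.distrib mult.assoc add_ac)
qed

lemma du_func: "du s (func c) = (if s = 0 then func (cderiv c) else 0)"
  and dtheta_func: "dtheta s (func c) = 0"
  by (rule ahat_eqI; auto simp: du.rep_eq dtheta.rep_eq func.rep_eq monc_def coeff_simps)+

lemma one_eq_func: "1 = func 1"
  by (rule ahat_eqI) (simp add: one_ahat.rep_eq func.rep_eq)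

lemma cderiv_one: "cderiv 1 = 0"
  using cderiv_const[of 1] by simp

lemma func_zero: "func 0 = 0"
  by (rule ahat_eqI) (simp add: func.rep_eq monc_def coeff_simps)

lemma du_one: "du s 1 = 0" and dtheta_one: "dtheta s 1 = 0"
  by (simp_all add: one_eq_func du_func dtheta_func cderiv_one func_zero)

lemma du_upos: "j \<noteq> 0 \<Longrightarrow> du s (upos j) = (if s = j then 1 else 0)"
  and dtheta_upos: "j \<noteq> 0 \<Longrightarrow> dtheta s (upos j) = 0"
  and du_theta: "du s (theta j) = 0"
  and dtheta_theta: "dtheta s (theta j) = (if s = j then 1 else 0)"
  using du_upos_times[of j s 1] dtheta_upos_times[of j s 1] du_theta_times[of s j 1]
    dtheta_theta_times[of s j 1]
  by (simp_all add: du_one dtheta_one)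

lemmas du_gens = du_func dtheta_func du_upos dtheta_upos du_theta dtheta_theta

lemma vfield_func: "vfield A B (func c) = A 0 * func (cderiv c)"
  by (subst vfield_sum[of 0]) (simp_all add: du_gens)

lemma vfield_upos: "j \<noteq> 0 \<Longrightarrow> vfield A B (upos j) = A j"
  by (subst vfield_sum[of j]) (simp_all add: du_gens mult_delta_right)

lemma vfield_theta: "vfield A B (theta j) = B j"
  by (subst vfield_sum[of j]) (simp_all add: du_gens mult_delta_right)

lemmas vfield_gens = vfield_func vfield_upos vfield_theta

lemma deriv_eqI:
  assumes X: "deriv_on_polys e X" and Y: "deriv_on_polys e Y"
    and func: "\<And>c. X (func c) = Y (func c)"
    and upos: "\<And>s. s \<noteq> 0 \<Longrightarrow> X (upos s) = Y (upos s)"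
    and theta: "\<And>s. X (theta s) = Y (theta s)"
    and f: "f \<in> polys"
  shows "X f = Y f"
  using f
proof (induction f rule: polys_induct)
  case zero
  then show ?case by (simp add: deriv_zero[OF X] deriv_zero[OF Y])
qed (simp_all add: derivD(4,5)[OF X] derivD(4,5)[OF Y] func upos theta polys_gens)

text \<open>The supercommutator, an anticommutator if both derivations are odd. Together with
  \<open>deriv_eqI\<close> it turns the operator identities below into checks on generators.\<close>

lemma deriv_commutator:
  assumes X: "deriv_on_polys e X" and Y: "deriv_on_polys e' Y"
  shows "deriv_on_polys (e \<noteq> e') (\<lambda>f. X (Y f) - (if e \<and> e' then - 1 else 1) *\<^sub>R Y (X f))"
  unfolding deriv_on_polys_def
proof (intro ballI conjI allI)
  fix f assume f: "f \<in> polys"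
  note X' = derivD[OF X] deriv_minus[OF X] and Y' = derivD[OF Y] deriv_minus[OF Y]
  show "X (Y f) - (if e \<and> e' then - 1 else 1) *\<^sub>R Y (X f) \<in> polys"
    using X'(1) Y'(1) f by auto
  show "super (X (Y f) - (if e \<and> e' then - 1 else 1) *\<^sub>R Y (X f)) =
      (if e \<noteq> e' then - (X (Y (super f)) - (if e \<and> e' then - 1 else 1) *\<^sub>R Y (X (super f)))
       else X (Y (super f)) - (if e \<and> e' then - 1 else 1) *\<^sub>R Y (X (super f)))"
    using f by (cases e; cases e') (simp_all add: X' Y' super_linear polys_super polys_uminus)
  show "X (Y (r *\<^sub>R f)) - (if e \<and> e' then - 1 else 1) *\<^sub>R Y (X (r *\<^sub>R f)) =
      r *\<^sub>R (X (Y f) - (if e \<and> e' then - 1 else 1) *\<^sub>R Y (X f))" for r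
    using f by (simp add: X' Y' scaleR_diff_right)
  fix g assume g: "g \<in> polys"
  show "X (Y (f + g)) - (if e \<and> e' then - 1 else 1) *\<^sub>R Y (X (f + g)) =
      X (Y f) - (if e \<and> e' then - 1 else 1) *\<^sub>R Y (X f) + (X (Y g) - (if e \<and> e' then - 1 else 1) *\<^sub>R Y (X g))"
    using f g by (simp add: X' Y' algebra_simps)
  show "X (Y (f * g)) - (if e \<and> e' then - 1 else 1) *\<^sub>R Y (X (f * g)) =
      (X (Y f) - (if e \<and> e' then - 1 else 1) *\<^sub>R Y (X f)) * g +
      twist (e \<noteq> e') f * (X (Y g) - (if e \<and> e' then - 1 else 1) *\<^sub>R Y (X g))"
    using f g
    by (cases e; cases e')
      (simp_all add: X' Y' twist_def polys_super polys_times algebra_simps)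
qed

section \<open>The total derivative and the two differentials\<close>

lemma polys_one [intro]: "1 \<in> polys"
  by (simp add: one_eq_func polys_gens)

lemmas polys_intros = polys_add polys_diff polys_uminus polys_times polys_scaleR polys_0 polys_one
  polys_gens polys_du polys_dtheta polys_super

lemma theta_anticommute: "theta j * theta i = - (theta i * theta j)"
  using theta_commute[of j "theta i"] by (simp add: super_theta)

lemma theta_anticommute': "theta j * (theta i * x) = - (theta i * (theta j * x))"
  using theta_anticommute[of j i] by (simp flip: mult.assoc)

lemma theta_square: "theta j * theta j = 0"
  using theta_anticommute[of j j] by (simp add: eq_neg_iff_add_eq_0 flip: scaleR_2)

lemma theta_square': "theta j * (theta j * x) = 0"
  by (simp add: theta_square flip: mult.assoc)

lemma func_times: "func c * func d = func (c * d)"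
  by (rule ahat_eqI) (simp add: coeff_func_times func.rep_eq monc_def)

text \<open>Rewriting to the normal order \<open>f u\<^sup>i u\<^sup>j \<dots> \<theta>\<^sup>k \<theta>\<^sup>l \<dots>\<close>.\<close>

lemma normal_order:
  "theta j * func c = func c * theta j" "theta j * (func c * x) = func c * (theta j * x)"
  "upos s * func c = func c * upos s" "upos s * (func c * x) = func c * (upos s * x)"
  "theta j * upos s = upos s * theta j" "theta j * (upos s * x) = upos s * (theta j * x)"
  "i < j \<Longrightarrow> theta j * theta i = - (theta i * theta j)"
  "i < j \<Longrightarrow> theta j * (theta i * x) = - (theta i * (theta j * x))"
  "theta j * theta j = 0" "theta j * (theta j * x) = 0"
  "func c * func d = func (c * d)" "func c * (func d * x) = func (c * d) * x"
proof -
  have left: "x * y = y * x \<Longrightarrow> x * (y * z) = y * (x * z)" for x y z :: ahat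
    by (metis mult.assoc)
  show "theta j * func c = func c * theta j" "theta j * (func c * x) = func c * (theta j * x)"
    "upos s * func c = func c * upos s" "upos s * (func c * x) = func c * (upos s * x)"
    "theta j * upos s = upos s * theta j" "theta j * (upos s * x) = upos s * (theta j * x)"
    by (rule left | rule func_commute[symmetric] upos_commute[symmetric])+
  show "theta j * theta i = - (theta i * theta j)" "theta j * (theta i * x) = - (theta i * (theta j * x))"
    by (rule theta_anticommute theta_anticommute')+
  show "theta j * theta j = 0" "theta j * (theta j * x) = 0"
    "func c * func d = func (c * d)" "func c * (func d * x) = func (c * d) * x"
    by (simp_all add: theta_square theta_square' func_times flip: mult.assoc)
qed

lemma D2u_normal_order:
  "D2u * func c = func c * D2u" "D2u * (func c * x) = func c * (D2u * x)"
  "D2u * upos s = upos s * D2u" "D2u * (upos s * x) = upos s * (D2u * x)"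
  by (metis func_commute upos_commute mult.assoc)+

lemma tot_vfield: "tot = vfield (\<lambda>s. uvar (Suc s)) (\<lambda>s. theta (Suc s))"
  by (rule ext) (simp add: tot_def vfield_def)

lemma D1_vfield: "D1 = vfield (\<lambda>s. theta (Suc s)) (\<lambda>_. 0)"
  by (rule ext) (simp add: D1_def vfield_def)

lemma D2_vfield: "D2 = vfield (\<lambda>s. (tot ^^ s) D2u) (\<lambda>s. (tot ^^ s) D2theta)"
  by (rule ext) (simp add: D2_def vfield_def)

lemma uvar_Suc: "uvar (Suc s) = upos (Suc s)"
  by (simp add: uvar_def)

lemma uvar_0: "uvar 0 = func coord"
  by (simp add: uvar_def)

lemma cderiv_coord: "cderiv coord = 1"
  by transfer (auto simp: fun_eq_iff)

lemma parity_0: "has_parity e 0"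
  by (simp add: has_parity_def super_linear)

lemma parity_upos: "has_parity False (upos s)"
  by (simp add: has_parity_def super_upos)

lemma deriv_tot: "deriv_on_polys False tot"
  unfolding tot_vfield
  by (rule deriv_vfield) (simp_all add: uvar_Suc parity_upos parity_theta polys_intros)

lemma deriv_D1: "deriv_on_polys True D1"
  unfolding D1_vfield by (rule deriv_vfield) (simp_all add: parity_0 parity_theta polys_intros)

lemma tot_pow:
  assumes "f \<in> polys"
  shows "(tot ^^ s) f \<in> polys" "super ((tot ^^ s) f) = (tot ^^ s) (super f)"
proof -
  have "(tot ^^ s) f \<in> polys \<and> super ((tot ^^ s) f) = (tot ^^ s) (super f)"
    using assms by (induction s) (simp_all add: derivD[OF deriv_tot])
  then show "(tot ^^ s) f \<in> polys" "super ((tot ^^ s) f) = (tot ^^ s) (super f)" by auto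
qed

lemma tot_pow_minus: "f \<in> polys \<Longrightarrow> (tot ^^ s) (- f) = - (tot ^^ s) f"
  by (induction s) (simp_all add: deriv_minus[OF deriv_tot] tot_pow)

lemma tot_pow_scaleR: "f \<in> polys \<Longrightarrow> (tot ^^ s) (r *\<^sub>R f) = r *\<^sub>R (tot ^^ s) f"
  by (induction s) (simp_all add: derivD[OF deriv_tot] tot_pow)

lemma tot_pow_0: "(tot ^^ s) 0 = 0"
  using tot_pow_scaleR[OF polys_0, of s 0] by simp

lemma D2u_polys: "D2u \<in> polys" and D2theta_polys: "D2theta \<in> polys"
  by (simp_all add: D2u_def D2theta_def polys_intros)

lemma tot_pow_D2_parity: "has_parity True ((tot ^^ s) D2u)" "has_parity False ((tot ^^ s) D2theta)"
proof -
  have "super D2u = - D2u"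
    by (simp add: D2u_def uvar_0 uvar_Suc super_linear super_times super_func super_upos super_theta)
  then show "has_parity True ((tot ^^ s) D2u)"
    by (simp add: has_parity_def tot_pow D2u_polys tot_pow_minus)
  have "super D2theta = D2theta"
    by (simp add: D2theta_def super_linear super_times super_theta)
  then show "has_parity False ((tot ^^ s) D2theta)"
    by (simp add: has_parity_def tot_pow D2theta_polys)
qed

lemma deriv_D2: "deriv_on_polys True D2"
  unfolding D2_vfield
  by (rule deriv_vfield) (simp_all add: tot_pow_D2_parity tot_pow D2u_polys D2theta_polys)

lemma deriv_dtheta: "deriv_on_polys True (dtheta s)"
  unfolding deriv_on_polys_def
  by (simp add: polys_dtheta super_dtheta dtheta_scaleR dtheta_add dtheta_times twist_def)

lemma deriv_null: "deriv_on_polys e (\<lambda>_. 0)"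
  unfolding deriv_on_polys_def by (simp add: polys_0 super_linear)

section \<open>Values on generators, and the relations between \<open>tot\<close>, \<open>D1\<close>
  and \<open>D2\<close>\<close>

lemma tot_gens:
  "tot (func c) = upos (Suc 0) * func (cderiv c)" "tot (upos (Suc s)) = upos (Suc (Suc s))"
  "tot (theta s) = theta (Suc s)"
  by (simp_all add: tot_vfield vfield_gens uvar_Suc)

lemma D1_gens:
  "D1 (func c) = theta (Suc 0) * func (cderiv c)" "s \<noteq> 0 \<Longrightarrow> D1 (upos s) = theta (Suc s)" "D1 (theta s) = 0"
  by (simp_all add: D1_vfield vfield_gens)

lemma D2_gens:
  "D2 (func c) = D2u * func (cderiv c)" "s \<noteq> 0 \<Longrightarrow> D2 (upos s) = (tot ^^ s) D2u" "D2 (theta s) = (tot ^^ s) D2theta"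
  by (simp_all add: D2_vfield vfield_gens)

lemmas tot_rules = derivD(3-5)[OF deriv_tot] deriv_minus[OF deriv_tot] deriv_diff[OF deriv_tot] deriv_zero[OF deriv_tot]
lemmas D1_rules = derivD(3-5)[OF deriv_D1] deriv_minus[OF deriv_D1] deriv_diff[OF deriv_D1] deriv_zero[OF deriv_D1]
lemmas D2_rules = derivD(3-5)[OF deriv_D2] deriv_minus[OF deriv_D2] deriv_diff[OF deriv_D2] deriv_zero[OF deriv_D2]

text \<open>\<open>D1\<close> is evolutionary: its value on \<open>u^s\<close> is
  \<open>tot ^^ s\<close> applied to its value \<open>theta 1\<close> on \<open>u\<close>, and it
  kills every \<open>theta s\<close>. \<open>D2\<close> in the next lemma is evolutionary by its
  definition.\<close>

lemma D1_tot:
  assumes "f \<in> polys" shows "D1 (tot f) = tot (D1 f)"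
proof -
  have "D1 (tot f) - (if True \<and> False then - 1 else 1) *\<^sub>R tot (D1 f) = (\<lambda>_. 0) f"
  proof (rule deriv_eqI[OF deriv_commutator[OF deriv_D1 deriv_tot] deriv_null _ _ _ assms])
    show "D1 (tot (func c)) - (if True \<and> False then - 1 else 1) *\<^sub>R tot (D1 (func c)) = 0" for c
      by (simp add: tot_gens D1_gens D1_rules tot_rules polys_intros twist_def super_upos super_func normal_order mult.assoc)
  next
    fix s :: nat assume "s \<noteq> 0"
    then obtain r where "s = Suc r" by (cases s) auto
    then show "D1 (tot (upos s)) - (if True \<and> False then - 1 else 1) *\<^sub>R tot (D1 (upos s)) = 0"
      by (simp add: tot_gens D1_gens)
  qed (simp add: tot_gens D1_gens tot_rules)
  then show ?thesis by simp
qed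

lemma D2_tot:
  assumes "f \<in> polys" shows "D2 (tot f) = tot (D2 f)"
proof -
  have "D2 (tot f) - (if True \<and> False then - 1 else 1) *\<^sub>R tot (D2 f) = (\<lambda>_. 0) f"
  proof (rule deriv_eqI[OF deriv_commutator[OF deriv_D2 deriv_tot] deriv_null _ _ _ assms])
    show "D2 (tot (func c)) - (if True \<and> False then - 1 else 1) *\<^sub>R tot (D2 (func c)) = 0" for c
      by (simp add: tot_gens D2_gens D2_rules tot_rules polys_intros D2u_polys twist_def super_upos super_func D2u_normal_order normal_order mult.assoc)
  next
    fix s :: nat assume "s \<noteq> 0"
    then obtain r where "s = Suc r" by (cases s) auto
    then show "D2 (tot (upos s)) - (if True \<and> False then - 1 else 1) *\<^sub>R tot (D2 (upos s)) = 0"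
      by (simp add: tot_gens D2_gens)
  qed (simp add: tot_gens D2_gens)
  then show ?thesis by simp
qed

lemma D1_tot_pow: "f \<in> polys \<Longrightarrow> D1 ((tot ^^ s) f) = (tot ^^ s) (D1 f)"
  and D2_tot_pow: "f \<in> polys \<Longrightarrow> D2 ((tot ^^ s) f) = (tot ^^ s) (D2 f)"
  by (induction s) (simp_all add: D1_tot D2_tot tot_pow)

text \<open>The anticommutator of an odd derivation with itself is twice its square.\<close>

lemma D1_D1:
  assumes "f \<in> polys" shows "D1 (D1 f) = 0"
proof -
  have "D1 (D1 f) - (if True \<and> True then - 1 else 1) *\<^sub>R D1 (D1 f) = (\<lambda>_. 0) f"
    by (rule deriv_eqI[OF deriv_commutator[OF deriv_D1 deriv_D1] deriv_null _ _ _ assms])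
      (simp_all add: D1_gens D1_rules polys_intros twist_def super_theta normal_order mult.assoc)
  then show ?thesis by (simp flip: scaleR_2)
qed

lemma D2_D2u: "D2 D2u = 0"
proof -
  \<comment> \<open>The factor 4 clears the products of two halves from \<open>D2u\<close> and
    \<open>D2theta\<close>.\<close>
  have "4 *\<^sub>R D2 D2u = 0"
    by (simp add: D2u_def D2theta_def uvar_0 uvar_Suc D2_rules D2_gens tot_rules tot_gens polys_intros twist_def
        super_func super_upos cderiv_coord normal_order algebra_simps scaleR_2 flip: one_eq_func)
  then show ?thesis by simp
qed

lemma D2_D2theta: "D2 D2theta = 0"
  by (simp add: D2theta_def D2_rules D2_gens tot_rules tot_gens polys_intros twist_def
        super_theta normal_order algebra_simps)

text \<open>This is anticommutation on the coordinate \<open>u\<close>: \<open>D1\<close> sends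
  \<open>u\<close> to \<open>theta 1\<close>, and \<open>D2\<close> sends \<open>theta 1\<close> to
  \<open>tot D2theta\<close>.\<close>

lemma D1_D2u: "D1 D2u = - tot D2theta"
  by (simp add: D2u_def D2theta_def uvar_0 uvar_Suc D1_rules D1_gens tot_rules tot_gens polys_intros twist_def
        super_func super_upos cderiv_coord normal_order algebra_simps scaleR_2 flip: one_eq_func)

lemma D1_D2theta: "D1 D2theta = 0"
  by (simp add: D2theta_def D1_rules D1_gens polys_intros)

lemma D2u_anticommute: "D2u * (theta j * x) = - (theta j * (D2u * x))"
  using theta_commute[of j D2u] tot_pow_D2_parity(1)[of 0]
  by (simp add: has_parity_def flip: mult.assoc)

lemma D2u_square: "D2u * D2u = 0"
proof -
  have "super D2u = - D2u" using tot_pow_D2_parity(1)[of 0] by (simp add: has_parity_def)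
  then have "D2u * D2u = - (D2u * D2u)"
    using supercommute[OF tot_pow_D2_parity(1)[of 0], of D2u] by (simp add: twist_def)
  then show ?thesis by (simp add: eq_neg_iff_add_eq_0 flip: scaleR_2)
qed

text \<open>As \<open>D2\<close> commutes with \<open>tot\<close>, the values on \<open>u^s\<close>
  and \<open>theta s\<close> reduce to \<open>D2_D2u\<close> and \<open>D2_D2theta\<close>. On a
  function the second-order term contains \<open>D2u * D2u\<close>, which vanishes since
  \<open>D2u\<close> is odd.\<close>

lemma D2_D2:
  assumes "f \<in> polys" shows "D2 (D2 f) = 0"
proof -
  have "D2 (D2 f) - (if True \<and> True then - 1 else 1) *\<^sub>R D2 (D2 f) = (\<lambda>_. 0) f"
  proof (rule deriv_eqI[OF deriv_commutator[OF deriv_D2 deriv_D2] deriv_null _ _ _ assms])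
    have "super D2u = - D2u" using tot_pow_D2_parity(1)[of 0] by (simp add: has_parity_def)
    then have "D2 (D2 (func c)) = 0" for c
      by (simp add: D2_gens D2_rules polys_intros D2u_polys twist_def D2_D2u D2u_square flip: mult.assoc)
    then show "D2 (D2 (func c)) - (if True \<and> True then - 1 else 1) *\<^sub>R D2 (D2 (func c)) = 0" for c
      by simp
  qed (simp_all add: D2_gens D2_tot_pow D2u_polys D2theta_polys D2_D2u D2_D2theta tot_pow_0)
  then show ?thesis by (simp flip: scaleR_2)
qed

lemma D1_D2:
  assumes "f \<in> polys" shows "D1 (D2 f) = - D2 (D1 f)"
proof -
  have "D1 (D2 f) - (if True \<and> True then - 1 else 1) *\<^sub>R D2 (D1 f) = (\<lambda>_. 0) f"
  proof (rule deriv_eqI[OF deriv_commutator[OF deriv_D1 deriv_D2] deriv_null _ _ _ assms])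
    have "super D2u = - D2u" using tot_pow_D2_parity(1)[of 0] by (simp add: has_parity_def)
    then have "D1 (D2 (func c)) + D2 (D1 (func c)) = 0" for c
      by (simp add: D1_gens D2_gens D1_rules D2_rules polys_intros D2u_polys twist_def super_theta D1_D2u
          D2u_anticommute)
    then show "D1 (D2 (func c)) - (if True \<and> True then - 1 else 1) *\<^sub>R D2 (D1 (func c)) = 0" for c
      by simp
  qed (simp_all add: D1_gens D2_gens D1_tot_pow D2u_polys D2theta_polys D1_D2u D1_D2theta tot_pow_0 D2_rules
      tot_pow_minus derivD(1)[OF deriv_tot] funpow_swap1)
  then show ?thesis by (simp add: eq_neg_iff_add_eq_0)
qed

lemma tot_one: "tot 1 = 0"
  by (simp add: one_eq_func tot_gens cderiv_one func_zero)

text \<open>Among the coefficients of \<open>tot\<close>, \<open>theta 1\<close> occurs only in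
  \<open>theta 1 * dtheta 0\<close>, and \<open>theta 0\<close> does not occur.\<close>

lemma dtheta_tot:
  assumes "f \<in> polys"
  shows "dtheta (Suc 0) (tot f) = tot (dtheta (Suc 0) f) + dtheta 0 f" "dtheta 0 (tot f) = tot (dtheta 0 f)"
proof -
  have "dtheta (Suc 0) (tot f) - (if True \<and> False then - 1 else 1) *\<^sub>R tot (dtheta (Suc 0) f) = dtheta 0 f"
  proof (rule deriv_eqI[OF deriv_commutator[OF deriv_dtheta deriv_tot] _ _ _ _ assms])
    show "deriv_on_polys (True \<noteq> False) (dtheta 0)" by (simp add: deriv_dtheta)
  next
    fix s :: nat assume "s \<noteq> 0"
    then obtain r where "s = Suc r" by (cases s) auto
    then show "dtheta (Suc 0) (tot (upos s)) - (if True \<and> False then - 1 else 1) *\<^sub>R tot (dtheta (Suc 0) (upos s))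
        = dtheta 0 (upos s)"
      by (simp add: tot_gens dtheta_upos tot_rules)
  qed (simp_all add: tot_gens dtheta_func dtheta_theta dtheta_upos_times tot_rules tot_one)
  then show "dtheta (Suc 0) (tot f) = tot (dtheta (Suc 0) f) + dtheta 0 f" by (simp add: algebra_simps)
  have "dtheta 0 (tot f) - (if True \<and> False then - 1 else 1) *\<^sub>R tot (dtheta 0 f) = (\<lambda>_. 0) f"
  proof (rule deriv_eqI[OF deriv_commutator[OF deriv_dtheta deriv_tot] deriv_null _ _ _ assms])
    fix s :: nat assume "s \<noteq> 0"
    then obtain r where "s = Suc r" by (cases s) auto
    then show "dtheta 0 (tot (upos s)) - (if True \<and> False then - 1 else 1) *\<^sub>R tot (dtheta 0 (upos s)) = 0"
      by (simp add: tot_gens dtheta_upos tot_rules)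
  qed (simp_all add: tot_gens dtheta_func dtheta_theta dtheta_upos_times tot_rules tot_one)
  then show "dtheta 0 (tot f) = tot (dtheta 0 f)" by simp
qed

text \<open>The commutator \<open>dtheta 0\<close> commutes with \<open>tot\<close> again, hence the
  factor \<open>s\<close>, as in the derivative of a power. At \<open>s = 0\<close> this factor
  cancels the term with the truncated exponent \<open>s - 1\<close>.\<close>

lemma dtheta_tot_pow:
  assumes "f \<in> polys"
  shows "dtheta (Suc 0) ((tot ^^ s) f) = (tot ^^ s) (dtheta (Suc 0) f) + real s *\<^sub>R (tot ^^ (s - 1)) (dtheta 0 f)"
proof -
  have 0: "dtheta 0 ((tot ^^ s) f) = (tot ^^ s) (dtheta 0 f)" for s
    by (induction s) (simp_all add: dtheta_tot tot_pow assms)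
  show ?thesis
  proof (induction s)
    case (Suc s)
    have "tot (real s *\<^sub>R (tot ^^ (s - 1)) (dtheta 0 f)) = real s *\<^sub>R (tot ^^ s) (dtheta 0 f)"
      by (cases s) (simp_all add: tot_rules tot_pow assms polys_intros)
    then show ?case
      by (simp add: dtheta_tot tot_pow assms Suc tot_rules polys_intros 0 algebra_simps)
  qed simp
qed

section \<open>Two homotopies\<close>

text \<open>Euler operators: a weight that is additive when a monomial is split into two factors
  acts on each term of a product by the sum of the two weights.\<close>

lemma deriv_diag:
  assumes w: "\<And>a b S T. b \<subseteq># a \<Longrightarrow> T \<subseteq> S \<Longrightarrow> finite S \<Longrightarrow> w a S = w b T + w (a - b) (S - T)"
  shows "deriv_on_polys False (diag w)"
  unfolding deriv_on_polys_def
proof (intro ballI conjI allI)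
  fix f assume "f \<in> polys"
  then show "diag w f \<in> polys" ..
  show "super (diag w f) = (if False then - diag w (super f) else diag w (super f))"
    by (rule ahat_eqI) (simp add: super_def)
  show "diag w (r *\<^sub>R f) = r *\<^sub>R diag w f" for r by (rule diag_scaleR)
  fix g
  show "diag w (f + g) = diag w f + diag w g" by (rule diag_add)
  show "diag w (f * g) = diag w f * g + twist False f * diag w g"
  proof (rule ahat_eqI)
    fix a S
    show "coeff (diag w (f * g)) a S = coeff (diag w f * g + twist False f * diag w g) a S"
    proof (cases "finite S")
      case True
      have "coeff (diag w (f * g)) a S = (\<Sum>(b, T) \<in> splits a S.
          (w b T + w (a - b) (S - T)) *\<^sub>R (ksign T (S - T) * coeff f b T * coeff g (a - b) (S - T)))"
        unfolding coeff_diag times_ahat.rep_eq mulc_def scaleR_sum_right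
        by (rule sum.cong) (auto simp: splits_def True simp flip: w)
      also have "\<dots> = coeff (diag w f * g + twist False f * diag w g) a S"
        unfolding coeff_simps times_ahat.rep_eq mulc_def twist_def
        by (simp add: scaleR_add_left split_def sum.distrib)
      finally show ?thesis .
    qed (simp add: coeff_infinite)
  qed
qed

lemma diag_gens:
  "diag w (func c) = w {#} {} *\<^sub>R func c" "s \<noteq> 0 \<Longrightarrow> diag w (upos s) = w {#s#} {} *\<^sub>R upos s"
  "diag w (theta s) = w {#} {s} *\<^sub>R theta s"
  by (rule ahat_eqI; simp add: func.rep_eq upos.rep_eq theta.rep_eq monc_def coeff_simps)+

section \<open>The homotopy \<open>dtheta 1\<close> for the shifted second differential\<close>

lemma card_split:
  assumes "T \<subseteq> S" "finite S"
  shows "card S = card T + card (S - T)"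
  using assms by (simp add: card_Diff_subset card_mono finite_subset)

lemma size_split: "b \<subseteq># a \<Longrightarrow> size a = size b + size (a - b)"
  by (simp add: size_Diff_submset size_mset_mono)

text \<open>In \<open>(tot ^^ s) D2u\<close> the undifferentiated \<open>u\<close> occurs only in
  the term \<open>u theta^(s+1)\<close>, which is removed here.\<close>

definition D2_shift :: "ahat \<Rightarrow> ahat" where
  "D2_shift = vfield (\<lambda>s. (tot ^^ s) D2u - uvar 0 * theta (Suc s)) (\<lambda>s. (tot ^^ s) D2theta)"

lemma deriv_D2_shift: "deriv_on_polys True D2_shift"
  unfolding D2_shift_def
proof (rule deriv_vfield)
  show "has_parity True ((tot ^^ s) D2u - uvar 0 * theta (Suc s))" for s
    using tot_pow_D2_parity(1)[of s]
    by (simp add: has_parity_def super_linear super_times super_func super_theta uvar_0)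
qed (simp_all add: tot_pow_D2_parity tot_pow D2u_polys D2theta_polys polys_intros)

lemma D2_shift_eq:
  assumes "f \<in> polys"
  shows "D2_shift f = D2 f - uvar 0 * D1 f"
proof -
  obtain n where n: "\<And>s. s > n \<Longrightarrow> du s f = 0 \<and> dtheta s f = 0"
    using polys_finitely_many_vars[OF assms] by meson
  show ?thesis
    unfolding D1_vfield D2_vfield D2_shift_def
    by (subst (1 2 3) vfield_sum[where n = n])
      (simp_all add: n sum_distrib_left algebra_simps sum_subtractf sum.distrib)
qed

text \<open>A factor \<open>u^s\<close> contributes \<open>1 + s/2\<close> and a factor
  \<open>theta s\<close> contributes \<open>(s - 1)/2\<close>, the multiples found in
  \<open>dtheta_D2_gens\<close>.\<close>

definition theta1_weight :: "nat multiset \<Rightarrow> nat set \<Rightarrow> real" where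
  "theta1_weight a S = real (size a) + (real (mdeg a S) - real (card S)) / 2"

text \<open>The derivatives of \<open>D2u\<close> in \<open>theta 1\<close> and
  \<open>theta 0\<close> are \<open>u\<close> and \<open>u^1 / 2\<close>, those of
  \<open>D2theta\<close> are \<open>- theta 0 / 2\<close> and \<open>theta 1 / 2\<close>. In
  \<open>dtheta_tot_pow\<close> each pair combines to a multiple of \<open>u^s\<close> or
  \<open>theta s\<close>.\<close>

lemma dtheta_D2_gens:
  "dtheta (Suc 0) ((tot ^^ s) D2u) = uvar s + (real s / 2) *\<^sub>R (uvar s)"
  "dtheta (Suc 0) ((tot ^^ s) D2theta) = ((real s - 1) / 2) *\<^sub>R theta s"
proof -
  have u: "(tot ^^ s) (func coord) = uvar s" for s
  proof (induction s)
    case (Suc s)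
    have "tot (uvar s) = uvar (Suc s)"
      by (cases s) (simp_all add: uvar_0 uvar_Suc tot_gens cderiv_coord flip: one_eq_func)
    then show ?case by (simp add: Suc)
  qed (simp add: uvar_0)
  have up: "(tot ^^ s) (upos (Suc 0)) = uvar (Suc s)" for s
    by (induction s) (simp_all add: uvar_Suc tot_gens)
  have th: "(tot ^^ s) (theta j) = theta (s + j)" for s j
    by (induction s) (simp_all add: tot_gens)
  have 1: "dtheta (Suc 0) D2u = func coord" "dtheta 0 D2u = (1/2) *\<^sub>R upos (Suc 0)"
    by (simp_all add: D2u_def uvar_0 uvar_Suc dtheta_add dtheta_scaleR dtheta_func_times dtheta_upos_times
        dtheta_theta)
  have 2: "dtheta (Suc 0) D2theta = - (1/2) *\<^sub>R theta 0" "dtheta 0 D2theta = (1/2) *\<^sub>R theta (Suc 0)"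
    by (simp_all add: D2theta_def dtheta_scaleR dtheta_theta_times dtheta_theta)
  \<comment> \<open>For \<open>s = 0\<close> the truncated \<open>s - 1\<close> gives the wrong
    index, but the factor is 0.\<close>
  have s: "real s *\<^sub>R uvar (Suc (s - 1)) = real s *\<^sub>R uvar s" "real s *\<^sub>R theta (s - 1 + Suc 0) = real s *\<^sub>R theta s"
    by (cases s; simp)+
  show "dtheta (Suc 0) ((tot ^^ s) D2u) = uvar s + (real s / 2) *\<^sub>R uvar s"
    using s by (simp add: dtheta_tot_pow D2u_polys 1 u tot_pow_scaleR polys_intros up)
  show "dtheta (Suc 0) ((tot ^^ s) D2theta) = ((real s - 1) / 2) *\<^sub>R theta s"
    using arg_cong[OF s(2), of "\<lambda>x. (1/2) *\<^sub>R x"]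
    by (simp add: dtheta_tot_pow D2theta_polys 2 tot_pow_scaleR tot_pow_minus polys_intros th
        diff_divide_distrib scaleR_diff_left)
qed

text \<open>With \<open>D2\<close> alone the anticommutator would also contain \<open>u\<close>
  times the derivative in \<open>u\<close>. That term stems from \<open>u D1\<close> and disappears
  with it; what remains multiplies each generator by its weight.\<close>

lemma dtheta_D2_shift:
  assumes "f \<in> polys"
  shows "dtheta (Suc 0) (D2_shift f) + D2_shift (dtheta (Suc 0) f) = diag theta1_weight f"
proof -
  have "dtheta (Suc 0) (D2_shift f) - (if True \<and> True then - 1 else 1) *\<^sub>R D2_shift (dtheta (Suc 0) f) = diag theta1_weight f"
  proof (rule deriv_eqI[OF deriv_commutator[OF deriv_dtheta deriv_D2_shift] _ _ _ _ assms])
    show "deriv_on_polys (True \<noteq> True) (diag theta1_weight)"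
      unfolding simp_thms
    proof (rule deriv_diag)
      fix a b :: "nat multiset" and S T :: "nat set"
      assume h: "b \<subseteq># a" "T \<subseteq> S" "finite S"
      show "theta1_weight a S = theta1_weight b T + theta1_weight (a - b) (S - T)"
        unfolding theta1_weight_def card_split[OF h(2,3)] size_split[OF h(1)] mdeg_split[OF h] by (simp add: field_simps)
    qed
    show "dtheta (Suc 0) (D2_shift (func c)) - (if True \<and> True then - 1 else 1) *\<^sub>R D2_shift (dtheta (Suc 0) (func c))
        = diag theta1_weight (func c)" for c
    proof -
      have "D2_shift (func c) = (1/2) *\<^sub>R (upos (Suc 0) * (theta 0 * func (cderiv c)))"
        by (simp add: D2_shift_def vfield_gens D2u_def uvar_0 uvar_Suc mult.assoc)
      moreover have "D2_shift 0 = 0" by (rule deriv_zero[OF deriv_D2_shift])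
      ultimately show ?thesis
        by (simp add: dtheta_func diag_gens theta1_weight_def mdeg_def dtheta_scaleR dtheta_upos_times dtheta_theta_times)
    qed
  next
    fix s :: nat assume s: "s \<noteq> 0"
    have "D2_shift 0 = 0" by (rule deriv_zero[OF deriv_D2_shift])
    moreover have "dtheta (Suc 0) (func coord * theta (Suc s)) = 0"
      using s by (simp add: dtheta_func_times dtheta_theta)
    moreover have "dtheta x (f - g) = dtheta x f - dtheta x g" for x f g
      using dtheta_add[of x f "(-1) *\<^sub>R g"] dtheta_scaleR[of x "-1" g] by simp
    ultimately show "dtheta (Suc 0) (D2_shift (upos s)) - (if True \<and> True then - 1 else 1) *\<^sub>R D2_shift (dtheta (Suc 0) (upos s))
        = diag theta1_weight (upos s)"
      using s dtheta_D2_gens(1)[of s]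
      by (cases s) (simp_all add: D2_shift_def vfield_gens dtheta_upos diag_gens theta1_weight_def mdeg_def uvar_0 uvar_Suc
        scaleR_add_left scaleR_diff_left)
  next
    fix s
    have "D2_shift 0 = 0" by (rule deriv_zero[OF deriv_D2_shift])
    moreover have "D2_shift 1 = 0" by (simp add: D2_shift_def vfield_gens one_eq_func cderiv_one func_zero)
    moreover have "D2_shift (theta s) = (tot ^^ s) D2theta" by (simp add: D2_shift_def vfield_gens)
    ultimately show "dtheta (Suc 0) (D2_shift (theta s)) - (if True \<and> True then - 1 else 1) *\<^sub>R D2_shift (dtheta (Suc 0) (theta s))
        = diag theta1_weight (theta s)"
      by (simp only: dtheta_D2_gens dtheta_theta) (simp add: diag_gens theta1_weight_def mdeg_def)
  qed
  then show ?thesis by simp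
qed

section \<open>The Poincare lemma in the variables \<open>u^s\<close> with
  \<open>s \<ge> 1\<close>\<close>

definition jet_weight :: "nat multiset \<Rightarrow> nat set \<Rightarrow> real" where
  "jet_weight a S = real (size a) + real (card (S - {0, 1}))"

text \<open>The de Rham differential, with \<open>theta (Suc s)\<close> in the role of the one-form
  \<open>du^s\<close>; \<open>u\<close>, \<open>theta 0\<close> and \<open>theta 1\<close> are
  parameters.\<close>

definition jet_d :: "ahat \<Rightarrow> ahat" where
  "jet_d = vfield (\<lambda>s. if s = 0 then 0 else theta (Suc s)) (\<lambda>_. 0)"

text \<open>For \<open>s = 0\<close> and \<open>s = 1\<close> the coefficient is the junk value \<open>upos 0 = 0\<close>.\<close>

definition jet_homotopy :: "ahat \<Rightarrow> ahat" where
  "jet_homotopy = vfield (\<lambda>_. 0) (\<lambda>s. upos (s - 1))"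

lemma upos_0: "upos 0 = 0"
  by (rule ahat_eqI) (simp add: upos.rep_eq coeff_simps)

lemma deriv_jet_d: "deriv_on_polys True jet_d"
  unfolding jet_d_def by (rule deriv_vfield) (simp_all add: parity_0 parity_theta polys_intros)

lemma deriv_jet_homotopy: "deriv_on_polys True jet_homotopy"
  unfolding jet_homotopy_def by (rule deriv_vfield) (simp_all add: parity_0 parity_upos polys_intros)

lemma jet_d_gens: "jet_d (func c) = 0" "s \<noteq> 0 \<Longrightarrow> jet_d (upos s) = theta (Suc s)" "jet_d (theta s) = 0"
  by (simp_all add: jet_d_def vfield_gens)

lemma jet_homotopy_gens: "jet_homotopy (func c) = 0" "s \<noteq> 0 \<Longrightarrow> jet_homotopy (upos s) = 0" "jet_homotopy (theta s) = upos (s - 1)"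
  by (simp_all add: jet_homotopy_def vfield_gens)

text \<open>Cartan's formula: \<open>jet_homotopy\<close> is contraction with the Euler field, and
  the Lie derivative along that field counts the \<open>u^s\<close> and their differentials
  \<open>theta (Suc s)\<close>, hence the exclusion of the indices 0 and 1 in
  \<open>jet_weight\<close>.\<close>

lemma jet_d_jet_homotopy:
  assumes "f \<in> polys"
  shows "jet_d (jet_homotopy f) + jet_homotopy (jet_d f) = diag jet_weight f"
proof -
  have "jet_d (jet_homotopy f) - (if True \<and> True then - 1 else 1) *\<^sub>R jet_homotopy (jet_d f) = diag jet_weight f"
  proof (rule deriv_eqI[OF deriv_commutator[OF deriv_jet_d deriv_jet_homotopy] _ _ _ _ assms])
    show "deriv_on_polys (True \<noteq> True) (diag jet_weight)"
      unfolding simp_thms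
    proof (rule deriv_diag)
      fix a b :: "nat multiset" and S T :: "nat set"
      assume h: "b \<subseteq># a" "T \<subseteq> S" "finite S"
      have "S - {0, 1} - (T - {0, 1}) = S - T - {0, 1}" by auto
      then have "card (S - {0, 1}) = card (T - {0, 1}) + card (S - T - {0, 1})"
        using card_split[of "T - {0, 1}" "S - {0, 1}"] h by (metis Diff_mono finite_Diff order_refl)
      then show "jet_weight a S = jet_weight b T + jet_weight (a - b) (S - T)"
        unfolding jet_weight_def size_split[OF h(1)] by simp
    qed
  next
    fix s :: nat
    consider "s = 0" | "s = 1" | r where "s = Suc (Suc r)"
      by (metis One_nat_def not0_implies_Suc)
    then show "jet_d (jet_homotopy (theta s)) - (if True \<and> True then - 1 else 1) *\<^sub>R jet_homotopy (jet_d (theta s)) = diag jet_weight (theta s)"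
      by cases (simp_all add: jet_d_gens jet_homotopy_gens diag_gens jet_weight_def upos_0 deriv_zero[OF deriv_jet_d] deriv_zero[OF deriv_jet_homotopy])
  qed (simp_all add: jet_d_gens jet_homotopy_gens diag_gens jet_weight_def deriv_zero[OF deriv_jet_d] deriv_zero[OF deriv_jet_homotopy])
  then show ?thesis by simp
qed

text \<open>The two parts differ in their effect on the number of even factors: \<open>jet_d\<close>
  lowers it by one, the derivative in \<open>u\<close> keeps it.\<close>

lemma D1_eq_jet_d:
  assumes "f \<in> polys"
  shows "D1 f = jet_d f + theta 1 * du 0 f"
proof -
  obtain n where n: "\<And>s. s > n \<Longrightarrow> du s f = 0 \<and> dtheta s f = 0"
    using polys_finitely_many_vars[OF assms] by meson
  have "D1 f = (\<Sum>s\<le>n. theta (Suc s) * du s f)"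
    unfolding D1_vfield by (subst vfield_sum[where n = n]) (simp_all add: n)
  moreover have "jet_d f = (\<Sum>s\<le>n. if s = 0 then 0 else theta (Suc s) * du s f)"
    unfolding jet_d_def by (subst vfield_sum[where n = n]) (auto simp: n intro!: sum.cong)
  moreover have "theta 1 * du 0 f = (\<Sum>s\<le>n. if s = 0 then theta (Suc s) * du s f else 0)"
    by simp
  moreover have "(\<Sum>s\<le>n. theta (Suc s) * du s f) = (\<Sum>s\<le>n. if s = 0 then 0 else theta (Suc s) * du s f) +
      (\<Sum>s\<le>n. if s = 0 then theta (Suc s) * du s f else 0)"
    unfolding sum.distrib[symmetric] by (rule sum.cong) simp_all
  ultimately show ?thesis by simp
qed

text \<open>\<open>jet_d\<close> trades a \<open>u^s\<close> for \<open>theta (Suc s)\<close>, so it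
  commutes with weights unchanged by this trade. The lemma serves for the reciprocal of
  \<open>jet_weight\<close>.\<close>

lemma jet_d_diag:
  assumes f: "f \<in> polys"
    and w: "\<And>a S s. s \<noteq> 0 \<Longrightarrow> Suc s \<in> S \<Longrightarrow> finite S \<Longrightarrow> w (add_mset s a) (S - {Suc s}) = w a S"
  shows "jet_d (diag w f) = diag w (jet_d f)"
proof -
  have T: "theta (Suc s) * du s (diag w f) = diag w (theta (Suc s) * du s f)" if "s \<noteq> 0" for s
  proof (rule ahat_eqI)
    fix a S
    show "coeff (theta (Suc s) * du s (diag w f)) a S = coeff (diag w (theta (Suc s) * du s f)) a S"
      using that w by (cases "finite S") (simp_all add: coeff_theta_times du.rep_eq coeff_infinite)
  qed
  obtain n where n: "\<And>s. s > n \<Longrightarrow> (du s f = 0 \<and> dtheta s f = 0) \<and> (du s (diag w f) = 0 \<and> dtheta s (diag w f) = 0)"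
    using polys_common_vars[OF f polys_diag[OF f, of w]] by meson
  have sum: "diag w (sum F I) = (\<Sum>i\<in>I. diag w (F i))" for F and I :: "nat set"
    by (induction I rule: infinite_finite_induct) (simp_all add: diag_0 diag_add)
  show ?thesis
    unfolding jet_d_def by (subst (1 2) vfield_sum[where n = n]) (auto simp: n sum T diag_0 intro!: sum.cong)
qed

section \<open>Filtration by the number of even factors\<close>

text \<open>The coordinate \<open>u\<close> sits inside the coefficients and does not count as an
  even factor.\<close>

definition ufilt :: "nat \<Rightarrow> ahat set" where
  "ufilt q = {f. \<forall>a S. coeff f a S \<noteq> 0 \<longrightarrow> q \<le> size a}"

lemma ufilt_mono: "f \<in> ufilt q \<Longrightarrow> r \<le> q \<Longrightarrow> f \<in> ufilt r"
  unfolding ufilt_def by force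

lemma ufilt_0: "0 \<in> ufilt q"
  by (simp add: ufilt_def coeff_simps)

lemma ufilt_all: "f \<in> ufilt 0"
  by (simp add: ufilt_def)

lemma ufilt_add:
  assumes "f \<in> ufilt q" "g \<in> ufilt q"
  shows "f + g \<in> ufilt q"
  unfolding ufilt_def
proof (intro CollectI allI impI)
  fix a S assume "coeff (f + g) a S \<noteq> 0"
  then have "coeff f a S \<noteq> 0 \<or> coeff g a S \<noteq> 0" by (auto simp: coeff_simps)
  then show "q \<le> size a" using assms unfolding ufilt_def by blast
qed

lemma ufilt_scaleR: "f \<in> ufilt q \<Longrightarrow> r *\<^sub>R f \<in> ufilt q"
  unfolding ufilt_def by (simp add: coeff_simps)

lemma ufilt_uminus: "f \<in> ufilt q \<Longrightarrow> - f \<in> ufilt q"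
  unfolding ufilt_def by (simp add: coeff_simps)

lemma ufilt_diff: "f \<in> ufilt q \<Longrightarrow> g \<in> ufilt q \<Longrightarrow> f - g \<in> ufilt q"
  using ufilt_add[of f q "- g"] ufilt_uminus by simp

lemma ufilt_diag: "f \<in> ufilt q \<Longrightarrow> diag w f \<in> ufilt q"
  unfolding ufilt_def by simp blast

lemma ufilt_sum: "(\<And>i. i \<in> I \<Longrightarrow> F i \<in> ufilt q) \<Longrightarrow> sum F I \<in> ufilt q"
  by (induction I rule: infinite_finite_induct) (simp_all add: ufilt_0 ufilt_add)

lemma ufilt_times:
  assumes "f \<in> ufilt q" "g \<in> ufilt r"
  shows "f * g \<in> ufilt (q + r)"
  unfolding ufilt_def
proof (intro CollectI allI impI)
  fix a S assume "coeff (f * g) a S \<noteq> 0"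
  then show "q + r \<le> size a"
    by (rule coeff_times_nonzero) (use assms size_split in \<open>fastforce simp: ufilt_def intro: add_mono\<close>)
qed

lemma ufilt_times_right: "g \<in> ufilt r \<Longrightarrow> f * g \<in> ufilt r"
  using ufilt_times[OF ufilt_all] by simp

lemma ufilt_du:
  assumes "f \<in> ufilt q"
  shows "du s f \<in> ufilt (if s = 0 then q else q - 1)"
  unfolding ufilt_def
proof (intro CollectI allI impI)
  fix a S assume h: "coeff (du s f) a S \<noteq> 0"
  have "coeff f (if s = 0 then a else add_mset s a) S \<noteq> 0"
    using h by (auto simp: du.rep_eq)
  then have "q \<le> size (if s = 0 then a else add_mset s a)"
    using assms unfolding ufilt_def by blast
  then show "(if s = 0 then q else q - 1) \<le> size a" by (simp split: if_splits)
qed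

lemma ufilt_dtheta:
  assumes "f \<in> ufilt q"
  shows "dtheta s f \<in> ufilt q"
  unfolding ufilt_def
proof (intro CollectI allI impI)
  fix a S assume "coeff (dtheta s f) a S \<noteq> 0"
  then have "coeff f a (insert s S) \<noteq> 0"
    by (auto simp: dtheta.rep_eq split: if_splits)
  then show "q \<le> size a"
    using assms unfolding ufilt_def by blast
qed

lemma ufilt_vfield:
  assumes "f \<in> polys" "\<And>s. A s * du s f \<in> ufilt q" "\<And>s. B s * dtheta s f \<in> ufilt q"
  shows "vfield A B f \<in> ufilt q"
proof -
  obtain n where n: "\<And>s. s > n \<Longrightarrow> du s f = 0 \<and> dtheta s f = 0"
    using polys_finitely_many_vars[OF assms(1)] by meson
  show ?thesis
    by (subst vfield_sum[where n = n]) (simp_all add: n assms ufilt_sum ufilt_add)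
qed

lemma ufilt_upos: "upos s \<in> ufilt 1"
  by (auto simp: ufilt_def upos.rep_eq monc_def)

lemma ufilt_upos_times:
  assumes "f \<in> ufilt (q - 1)"
  shows "upos s * f \<in> ufilt q"
  by (rule ufilt_mono[OF ufilt_times[OF ufilt_upos assms]]) simp

lemma ufilt_tot:
  assumes "f \<in> polys" "f \<in> ufilt q"
  shows "tot f \<in> ufilt q"
  unfolding tot_vfield uvar_Suc
proof (rule ufilt_vfield[OF assms(1)])
  show "upos (Suc s) * du s f \<in> ufilt q" for s
    by (rule ufilt_upos_times, rule ufilt_mono[OF ufilt_du[OF assms(2)]]) simp
qed (intro ufilt_times_right ufilt_dtheta assms)

lemma ufilt_jet_homotopy:
  assumes "f \<in> polys" "f \<in> ufilt q"
  shows "jet_homotopy f \<in> ufilt (Suc q)"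
  unfolding jet_homotopy_def
  by (rule ufilt_vfield[OF assms(1)]) (simp_all add: ufilt_0 ufilt_upos_times ufilt_dtheta assms)

text \<open>Each coefficient in front of \<open>du s\<close> has an even factor, which makes up for
  the one that \<open>du s\<close> may remove. The terms subtracted in \<open>D2_shift\<close> are
  exactly those without one.\<close>

lemma ufilt_D2_shift:
  assumes "f \<in> polys" "f \<in> ufilt q"
  shows "D2_shift f \<in> ufilt q"
  unfolding D2_shift_def
proof (rule ufilt_vfield[OF assms(1)])
  fix s
  have "(tot ^^ s) D2u - uvar 0 * theta (Suc s) \<in> ufilt 1 \<and> (tot ^^ s) D2u - uvar 0 * theta (Suc s) \<in> polys"
  proof (induction s)
    case 0
    show ?case
      by (simp add: D2u_def uvar_Suc uvar_0 polys_intros ufilt_scaleR ufilt_upos_times ufilt_all)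
  next
    case (Suc s)
    have u: "tot (uvar 0 * theta (Suc s)) = upos (Suc 0) * theta (Suc s) + uvar 0 * theta (Suc (Suc s))"
      by (simp add: uvar_0 tot_rules tot_gens polys_intros twist_def cderiv_coord flip: one_eq_func)
    \<comment> \<open>\<open>tot\<close> maps \<open>u theta^(s+1)\<close> to the next subtracted
      term plus \<open>u^1 theta^(s+1)\<close>. The latter is added back and has an even
      factor.\<close>
    have "(tot ^^ Suc s) D2u - uvar 0 * theta (Suc (Suc s)) =
        tot ((tot ^^ s) D2u - uvar 0 * theta (Suc s)) + upos (Suc 0) * theta (Suc s)"
      by (simp add: tot_rules tot_pow D2u_polys polys_intros u)
    moreover have "tot ((tot ^^ s) D2u - uvar 0 * theta (Suc s)) \<in> ufilt 1" using Suc ufilt_tot by blast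
    ultimately show ?case
      by (simp add: ufilt_add ufilt_upos_times ufilt_all derivD(1)[OF deriv_tot] Suc polys_intros)
  qed
  then have "((tot ^^ s) D2u - uvar 0 * theta (Suc s)) * du s f \<in> ufilt (1 + (q - 1))"
    by (intro ufilt_times ufilt_mono[OF ufilt_du[OF assms(2)]]) auto
  then show "((tot ^^ s) D2u - uvar 0 * theta (Suc s)) * du s f \<in> ufilt q"
    by (rule ufilt_mono) simp
qed (intro ufilt_times_right ufilt_dtheta assms)

section \<open>Bidegrees, and the correction of a cocycle order by order\<close>

lemma acomp_jet_homotopy:
  assumes "f \<in> acomp p d"
  shows "jet_homotopy f \<in> acomp (p - 1) (d - 1)"
  unfolding jet_homotopy_def vfield_def
proof (rule acomp_fsum)
  fix s
  show "0 * du s f + upos (s - 1) * dtheta s f \<in> acomp (p - 1) (d - 1)"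
  proof (cases "s = 0")
    case True
    then show ?thesis by (simp add: upos_0 acomp_def coeff_simps)
  next
    case False
    then show ?thesis
      using acomp_times[OF acomp_upos[of "s - 1"] acomp_dtheta[OF assms, of s]]
      by (simp add: of_nat_diff)
  qed
qed

lemma acomp_diag: "f \<in> acomp p d \<Longrightarrow> diag w f \<in> acomp p d"
  by (simp add: acomp_def) blast

lemma acomp_0: "0 \<in> acomp p d"
  by (simp add: acomp_def coeff_simps)

lemma acomp_uminus: "f \<in> acomp p d \<Longrightarrow> - f \<in> acomp p d"
  using acomp_scaleR[of f p d "-1"] by simp

lemma acomp_diff: "f \<in> acomp p d \<Longrightarrow> g \<in> acomp p d \<Longrightarrow> f - g \<in> acomp p d"
  using acomp_add[of f p d "- g"] acomp_uminus by simp

text \<open>The coefficients of \<open>jet_d\<close> are the \<open>theta (Suc s)\<close> with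
  \<open>s \<ge> 1\<close>, so \<open>theta 1\<close> does not occur in them.\<close>

lemma dtheta_jet_d:
  assumes "f \<in> polys"
  shows "jet_d (dtheta (Suc 0) f) = - dtheta (Suc 0) (jet_d f)"
proof -
  have "jet_d 0 = 0" by (rule deriv_zero[OF deriv_jet_d])
  moreover have "jet_d 1 = 0" by (simp add: one_eq_func jet_d_gens)
  ultimately have "jet_d (dtheta (Suc 0) f) - (if True \<and> True then - 1 else 1) *\<^sub>R dtheta (Suc 0) (jet_d f) = (\<lambda>_. 0) f"
    by (intro deriv_eqI[OF deriv_commutator[OF deriv_jet_d deriv_dtheta] deriv_null _ _ _ assms])
      (simp_all add: jet_d_gens dtheta_func dtheta_upos dtheta_theta)
  then show ?thesis by (simp add: eq_neg_iff_add_eq_0)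
qed

text \<open>The error is the sum of \<open>x - D2_shift y\<close> and
  \<open>D2_shift (y - D1 z)\<close>, both with more than \<open>q\<close> even factors.
  \<open>D2_shift\<close> may be replaced by \<open>D2\<close> on \<open>D1 z\<close> because
  \<open>D1\<close> squares to zero.\<close>

lemma cycle_step:
  assumes pd: "p < d" and x: "x \<in> acomp p d" and D1x: "D1 x = 0" and D2x: "D2 x = 0" and q: "x \<in> ufilt q"
  shows "\<exists>z \<in> acomp (p - 2) (d - 2). x - D2 (D1 z) \<in> ufilt (Suc q)"
proof -
  \<comment> \<open>The value of \<open>theta1_weight\<close> on the monomials of \<open>x\<close>
    with exactly \<open>q\<close> even factors; on these \<open>D2_shift y\<close> agrees with
    \<open>x\<close>.\<close>
  define n where "n = real q + (real_of_int d - real_of_int p) / 2"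
  have n: "n > 0" using pd by (simp add: n_def add_nonneg_pos)
  have xp: "x \<in> polys" using x by (rule acomp_polys)
  define y where "y = (1 / n) *\<^sub>R dtheta (Suc 0) x"
  have y: "y \<in> acomp (p - 1) (d - 1)"
    using acomp_dtheta[OF x, of 1] by (simp add: y_def acomp_scaleR)
  have yp: "y \<in> polys" using y by (rule acomp_polys)
  have yq: "y \<in> ufilt q" unfolding y_def by (intro ufilt_scaleR ufilt_dtheta q)
  have sx: "D2_shift x = 0" by (simp add: D2_shift_eq xp D1x D2x)
  have "D2_shift y = (1 / n) *\<^sub>R diag theta1_weight x"
    using dtheta_D2_shift[OF xp] by (simp add: y_def sx derivD[OF deriv_D2_shift] xp polys_intros)
  then have "x - D2_shift y \<in> ufilt (Suc q)"
    unfolding ufilt_def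
  proof (intro CollectI allI impI)
    fix a S assume e: "D2_shift y = (1 / n) *\<^sub>R diag theta1_weight x" and nz: "coeff (x - D2_shift y) a S \<noteq> 0"
    then have c: "coeff x a S \<noteq> 0" by (auto simp: coeff_simps)
    then have "q \<le> size a" using q unfolding ufilt_def by blast
    moreover have "size a \<noteq> q"
    proof
      assume "size a = q"
      moreover have "real (card S) = real_of_int p" "real (mdeg a S) = real_of_int d"
        using acompD[OF x c] by (metis of_int_of_nat_eq)+
      ultimately have "theta1_weight a S = n" by (simp add: theta1_weight_def n_def)
      then have "coeff (x - D2_shift y) a S = coeff x a S - (n / n) *\<^sub>R coeff x a S"
        unfolding e coeff_simps coeff_diag by simp
      then show False using nz n by simp
    qed
    ultimately show "Suc q \<le> size a" by simp
  qed
  moreover have "\<exists>z \<in> acomp (p - 2) (d - 2). y - D1 z \<in> ufilt (Suc q)"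
  proof -
    define w where "w a S = 1 / jet_weight a S" for a S
    \<comment> \<open>In general \<open>jet_d\<close> lowers the number of even factors to
      \<open>q - 1\<close>. Here \<open>D1 x = 0\<close> prevents this, and so the homotopy raises
      the remainder to more than \<open>q\<close>.\<close>
    have "jet_d x = - (theta 1 * du 0 x)"
      using D1_eq_jet_d[OF xp] D1x by (simp add: eq_neg_iff_add_eq_0)
    moreover have "theta 1 * du 0 x \<in> ufilt q"
      using ufilt_times_right[OF ufilt_du[OF q, of 0]] by simp
    ultimately have "jet_d x \<in> ufilt q" by (simp add: ufilt_uminus)
    then have "jet_d y \<in> ufilt q"
      by (simp add: y_def derivD[OF deriv_jet_d] dtheta_jet_d xp polys_intros ufilt_dtheta ufilt_uminus ufilt_scaleR)
    moreover have "jet_d (diag w y) = diag w (jet_d y)"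
    proof (rule jet_d_diag[OF yp])
      fix a :: "nat multiset" and S :: "nat set" and s :: nat
      assume s: "s \<noteq> 0" "Suc s \<in> S" "finite S"
      have "S - {0, 1} = insert (Suc s) (S - {Suc s} - {0, 1})" using s by auto
      then have "card (S - {0, 1}) = Suc (card (S - {Suc s} - {0, 1}))"
        using s(3) by (metis Diff_iff card_insert_disjoint finite_Diff insertI1)
      then show "w (add_mset s a) (S - {Suc s}) = w a S" by (simp add: w_def jet_weight_def)
    qed
    ultimately have k: "jet_homotopy (jet_d (diag w y)) \<in> ufilt (Suc q)"
      using ufilt_jet_homotopy ufilt_diag derivD(1)[OF deriv_jet_d yp] polys_diag by metis
    \<comment> \<open>Where \<open>jet_weight\<close> vanishes, \<open>w\<close> has the value
      \<open>1 / 0 = 0\<close>, so such monomials must be absent from \<open>y\<close>. Since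
      \<open>y\<close> is free of \<open>theta 1\<close>, they could only be 1 or
      \<open>theta 0\<close>; then \<open>d = 1\<close> and \<open>p \<ge> 1\<close>, against
      \<open>p < d\<close>.\<close>
    have "diag jet_weight (diag w y) = y"
    proof (rule ahat_eqI)
      fix a S
      have "jet_weight a S \<noteq> 0" if nz: "coeff y a S \<noteq> 0"
      proof
        have fin: "finite S" using nz coeff_infinite[of S y] by blast
        assume "jet_weight a S = 0"
        then have "a = {#}" "card (S - {0, 1}) = 0" by (auto simp: jet_weight_def add_nonneg_eq_0_iff)
        moreover have "1 \<notin> S" using nz by (auto simp: y_def coeff_simps dtheta.rep_eq)
        ultimately have "S \<subseteq> {0}" "a = {#}" using fin by auto
        then have "mdeg a S = 0" by (auto simp: mdeg_def subset_singleton_iff)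
        then show False using acompD[OF y nz] pd by linarith
      qed
      then show "coeff (diag jet_weight (diag w y)) a S = coeff y a S"
        by (cases "coeff y a S = 0") (simp_all add: w_def)
    qed
    then have d: "y - jet_d (jet_homotopy (diag w y)) = jet_homotopy (jet_d (diag w y))"
      using jet_d_jet_homotopy[OF polys_diag[OF yp, of w]] by (simp add: algebra_simps)
    define z where "z = jet_homotopy (diag w y)"
    have zp: "z \<in> polys" unfolding z_def by (intro derivD(1)[OF deriv_jet_homotopy] polys_diag yp)
    have "z \<in> ufilt (Suc q)" unfolding z_def by (intro ufilt_jet_homotopy ufilt_diag polys_diag yp yq)
    \<comment> \<open>The part of \<open>D1 z\<close> outside \<open>jet_d z\<close> is of higher
      order, as the homotopy has put an additional even factor into \<open>z\<close>.\<close>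
    then have "theta 1 * du 0 z \<in> ufilt (Suc q)"
      using ufilt_times_right[OF ufilt_du[of z "Suc q" 0]] by simp
    moreover have "y - D1 z = (y - jet_d z) - theta 1 * du 0 z"
      unfolding D1_eq_jet_d[OF zp] by simp
    ultimately have "y - D1 z \<in> ufilt (Suc q)" using k d[folded z_def] by (simp add: ufilt_diff)
    moreover have "z \<in> acomp (p - 2) (d - 2)"
      using acomp_jet_homotopy[OF acomp_diag[OF y, of w]] by (simp add: z_def)
    ultimately show ?thesis by blast
  qed
  then obtain z where z: "z \<in> acomp (p - 2) (d - 2)" "y - D1 z \<in> ufilt (Suc q)" by blast
  have zp: "z \<in> polys" "D1 z \<in> polys" using acomp_polys[OF z(1)] derivD(1)[OF deriv_D1] by auto
  have "D2_shift (y - D1 z) \<in> ufilt (Suc q)"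
    using z(2) yp zp by (intro ufilt_D2_shift polys_diff)
  moreover have "D2_shift (y - D1 z) = D2_shift y - D2 (D1 z)"
    by (simp add: deriv_diff[OF deriv_D2_shift] yp zp D2_shift_eq D1_D1)
  ultimately have "(x - D2_shift y) + (D2_shift y - D2 (D1 z)) \<in> ufilt (Suc q)"
    using \<open>x - D2_shift y \<in> ufilt (Suc q)\<close> by (intro ufilt_add) simp_all
  then show ?thesis using z(1) by auto
qed

lemma size_le_mdeg: "0 \<notin># a \<Longrightarrow> size a \<le> mdeg a S"
proof -
  assume "0 \<notin># a"
  then have "size a \<le> sum_mset a" by (induction a) auto
  then show ?thesis by (simp add: mdeg_def)
qed

text \<open>Repeating \<open>cycle_step\<close> raises \<open>q\<close> beyond \<open>d\<close>,
  where no monomial of degree \<open>d\<close> is left because each even factor has degree at least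
  1. The corrections are added up; \<open>m\<close> counts the remaining steps.\<close>

lemma cycle_exact:
  assumes pd: "p < d" and x: "x \<in> acomp p d" and D1x: "D1 x = 0" and D2x: "D2 x = 0"
  shows "\<exists>z \<in> acomp (p - 2) (d - 2). x = D2 (D1 z)"
proof -
  have "\<exists>z \<in> acomp (p - 2) (d - 2). x = D2 (D1 z)"
    if "x \<in> acomp p d" "D1 x = 0" "D2 x = 0" "x \<in> ufilt q" "q + m = Suc (nat d)" for x q m
    using that
  proof (induction m arbitrary: x q)
    case 0
    have "x = 0"
    proof (rule ahat_eqI)
      fix a S
      have False if nz: "coeff x a S \<noteq> 0"
      proof -
        have "q \<le> size a" using nz 0(4) unfolding ufilt_def by blast
        moreover have "size a \<le> mdeg a S" using nz coeff_zero_mem size_le_mdeg by metis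
        ultimately show False using acompD[OF 0(1) nz] 0(5) by linarith
      qed
      then show "coeff x a S = coeff 0 a S" by (auto simp: coeff_simps)
    qed
    then show ?case using acomp_0 D1_rules(6) D2_rules(6) by metis
  next
    case (Suc m)
    obtain z where z: "z \<in> acomp (p - 2) (d - 2)" "x - D2 (D1 z) \<in> ufilt (Suc q)"
      using cycle_step[OF pd Suc.prems(1-4)] by blast
    have zp: "z \<in> polys" by (rule acomp_polys[OF z(1)])
    have p: "D1 z \<in> polys" "D2 (D1 z) \<in> polys"
      using derivD(1)[OF deriv_D1] derivD(1)[OF deriv_D2] zp by auto
    have "D2 (D1 z) \<in> acomp p d" using acomp_D2[OF acomp_D1[OF z(1)]] by simp
    moreover have "D1 (x - D2 (D1 z)) = 0" "D2 (x - D2 (D1 z)) = 0"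
      using acomp_polys[OF Suc.prems(1)] p
      by (simp_all add: D1_rules D2_rules Suc.prems D1_D2 D1_D1 D2_D2 zp)
    ultimately obtain z' where z': "z' \<in> acomp (p - 2) (d - 2)" "x - D2 (D1 z) = D2 (D1 z')"
      using Suc.IH[of "x - D2 (D1 z)" "Suc q"] acomp_diff[OF Suc.prems(1)] z(2) Suc.prems(5) by auto
    have zp': "z' \<in> polys" by (rule acomp_polys[OF z'(1)])
    then have "x = D2 (D1 (z + z'))"
      using z'(2) zp p derivD(1)[OF deriv_D1] by (simp add: D1_rules D2_rules algebra_simps)
    then show ?case using acomp_add[OF z(1) z'(1)] by blast
  qed
  from this[of x 0 "Suc (nat d)"] show ?thesis using x D1x D2x ufilt_all by simp
qed

section \<open>Components of low degree\<close>

text \<open>The largest element is at least the number of the others, so \<open>k\<close> distinct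
  naturals have a sum of at least \<open>0 + 1 + ... + (k - 1)\<close>.\<close>

lemma card_le_sum:
  assumes "finite S"
  shows "card S * (card S - 1) \<le> 2 * \<Sum>(S :: nat set)"
  using assms
proof (induction S rule: finite_linorder_max_induct)
  case (insert b A)
  have "card A \<le> b"
    using card_mono[of "{..<b}" A] insert by auto
  moreover have "b \<notin> A" using insert by auto
  moreover have "Suc (card A) * card A \<le> card A * (card A - 1) + 2 * card A"
    by (cases "card A") simp_all
  ultimately show ?case using insert by simp
qed simp

text \<open>By \<open>card_le_sum\<close>, \<open>p\<close> distinct odd factors have degree at
  least \<open>p (p - 1) / 2\<close>. Negative \<open>d\<close> is included, as
  \<open>p (p - 1) \<ge> 0\<close> for every integer \<open>p\<close>.\<close>

lemma acomp_trivial: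
  assumes "p < 0 \<or> 2 * d < p * (p - 1)" and f: "f \<in> acomp p d"
  shows "f = 0"
proof (rule ahat_eqI)
  fix a S
  have False if nz: "coeff f a S \<noteq> 0"
  proof -
    note cm = acompD[OF f nz]
    have "finite S" using nz coeff_infinite by blast
    then have "card S * (card S - 1) \<le> 2 * mdeg a S"
      using card_le_sum[of S] by (simp add: mdeg_def)
    then have "int (card S * (card S - 1)) \<le> 2 * int (mdeg a S)" by linarith
    moreover have "int (card S * (card S - 1)) = p * (p - 1)"
      using cm by (cases "card S") (auto simp: algebra_simps)
    ultimately show False using assms(1) cm by linarith
  qed
  then show "coeff f a S = coeff 0 a S" by (auto simp: coeff_simps)
qed

lemma monomial_eq_0: "0 \<notin># a \<Longrightarrow> finite S \<Longrightarrow> monomial c a S = 0 \<Longrightarrow> c = 0"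
  using coeff_monomial[of a S c a S] by (simp add: coeff_simps)

lemma monomial_low:
  "monomial c {#} {0} = func c * theta 0"
  "monomial c {#} {1} = func c * theta 1"
  "monomial c {#} {0, 1} = func c * (theta 0 * theta 1)"
  "monomial c {#} {0, 2} = func c * (theta 0 * theta 2)"
  "monomial c {#} {0, 1, 2} = func c * (theta 0 * (theta 1 * theta 2))"
  "monomial c {#1#} {0} = func c * (upos 1 * theta 0)"
  "monomial c {#1#} {0, 1} = func c * (upos 1 * (theta 0 * theta 1))"
proof -
  have s: "monomial c {#} {j} = func c * theta j" for j
    using monomial_theta[of "{}" j c] by (simp add: monomial_empty normal_order)
  then show "monomial c {#} {0} = func c * theta 0" "monomial c {#} {1} = func c * theta 1" by auto
  have p: "monomial c {#} {i, j} = func c * (theta i * theta j)" if "i < j" for i j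
    using monomial_theta[of "{j}" i c] that by (simp add: s normal_order)
  from p show "monomial c {#} {0, 1} = func c * (theta 0 * theta 1)"
    "monomial c {#} {0, 2} = func c * (theta 0 * theta 2)" by auto
  have pos: "0 < i" if "i \<in> {1, 2}" for i :: nat using that by auto
  show "monomial c {#} {0, 1, 2} = func c * (theta 0 * (theta 1 * theta 2))"
    using monomial_theta[of "{1, 2}" 0 c, OF _ pos] p[of 1 2] by (simp add: normal_order)
  show "monomial c {#1#} {0} = func c * (upos 1 * theta 0)"
    "monomial c {#1#} {0, 1} = func c * (upos 1 * (theta 0 * theta 1))"
    using monomial_upos[of "{0}" "{#}" 1 c] monomial_upos[of "{0, 1}" "{#}" 1 c] s[of 0] p[of 0 1]
    by (simp_all add: normal_order)
qed

lemma sum_mset_eq_0: "0 \<notin># (a :: nat multiset) \<Longrightarrow> sum_mset a = 0 \<longleftrightarrow> a = {#}"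
  by (cases a) auto

lemma sum_mset_eq_1: "0 \<notin># (a :: nat multiset) \<Longrightarrow> sum_mset a = Suc 0 \<longleftrightarrow> a = {#1#}"
  by (cases a) (auto simp: add_is_1 sum_mset_eq_0 simp del: sum_mset_0_iff)

lemma small_sets:
  assumes "finite S" "\<Sum>S \<le> (3::nat)"
  shows "S \<in> Pow {0, 1, 2, 3}"
proof -
  have "s \<le> 3" if "s \<in> S" for s
    using member_le_sum[of s S "\<lambda>x. x"] that assms by simp
  then show ?thesis by force
qed

lemma coeff_acomp_cases:
  assumes f: "f \<in> acomp p d" and nz: "coeff f a S \<noteq> 0" and "d \<le> 3"
  obtains "S \<in> Pow {0, 1, 2, 3}" "card S = nat p" "sum_mset a + \<Sum>S = nat d" "0 \<notin># a"
proof -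
  have fin: "finite S" "0 \<notin># a" using nz coeff_infinite coeff_zero_mem by metis+
  have "card S = nat p" "sum_mset a + \<Sum>S = nat d"
    using acompD[OF f nz] unfolding mdeg_def by linarith+
  moreover have "S \<in> Pow {0, 1, 2, 3}"
    using calculation(2) \<open>d \<le> 3\<close> by (intro small_sets fin) linarith
  ultimately show ?thesis using that fin by blast
qed

text \<open>In each bidegree the sets of \<open>p\<close> odd indices with sum at most
  \<open>d\<close> are listed. They leave degree 0 or 1 for the even factors, so the multiset is
  empty or \<open>{#1#}\<close>.\<close>

lemma acomp_low:
  "f \<in> acomp 0 0 \<Longrightarrow> \<exists>c. f = func c"
  "f \<in> acomp 1 1 \<Longrightarrow> \<exists>c e. f = func c * (upos 1 * theta 0) + func e * theta 1"
  "f \<in> acomp 2 1 \<Longrightarrow> \<exists>c. f = func c * (theta 0 * theta 1)"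
  "f \<in> acomp 2 2 \<Longrightarrow> \<exists>c e. f = func c * (upos 1 * (theta 0 * theta 1)) + func e * (theta 0 * theta 2)"
  "f \<in> acomp 3 3 \<Longrightarrow> \<exists>c. f = func c * (theta 0 * (theta 1 * theta 2))"
proof -
  assume f: "f \<in> acomp 0 0"
  have h: "(a, S) \<in> {({#}, {})}" if "coeff f a S \<noteq> 0" for a S
    by (rule coeff_acomp_cases[OF f that]) (auto simp: Pow_insert sum_mset_eq_0 sum_mset_eq_1 simp del: sum_mset_0_iff)
  have "\<exists>c. f = (\<Sum>(a, S)\<in>{({#}, {})}. monomial (c a S) a S)"
  proof (rule monomial_expansion)
    show "0 \<notin># a \<and> finite S" if "(a, S) \<in> {({#}, {})}" for a :: "nat multiset" and S :: "nat set"
      using that by auto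
  qed (simp, rule h)
  then obtain c :: "nat multiset \<Rightarrow> nat set \<Rightarrow> cinf"
    where "f = monomial (c {#} {}) {#} {}" by auto
  then show "\<exists>c. f = func c"
    unfolding monomial_low monomial_empty by blast
next
  assume f: "f \<in> acomp 1 1"
  have h: "(a, S) \<in> {({#1#}, {0}), ({#}, {1})}" if "coeff f a S \<noteq> 0" for a S
    by (rule coeff_acomp_cases[OF f that]) (auto simp: Pow_insert sum_mset_eq_0 sum_mset_eq_1 simp del: sum_mset_0_iff)
  have "\<exists>c. f = (\<Sum>(a, S)\<in>{({#1#}, {0}), ({#}, {1})}. monomial (c a S) a S)"
  proof (rule monomial_expansion)
    show "0 \<notin># a \<and> finite S" if "(a, S) \<in> {({#1#}, {0}), ({#}, {1})}" for a :: "nat multiset" and S :: "nat set"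
      using that by auto
  qed (simp, rule h)
  then obtain c :: "nat multiset \<Rightarrow> nat set \<Rightarrow> cinf"
    where "f = monomial (c {#1#} {0}) {#1#} {0} + monomial (c {#} {1}) {#} {1}" by auto
  then show "\<exists>c e. f = func c * (upos 1 * theta 0) + func e * theta 1"
    unfolding monomial_low monomial_empty by blast
next
  assume f: "f \<in> acomp 2 1"
  have h: "(a, S) \<in> {({#}, {0, 1})}" if "coeff f a S \<noteq> 0" for a S
    by (rule coeff_acomp_cases[OF f that]) (auto simp: Pow_insert sum_mset_eq_0 sum_mset_eq_1 simp del: sum_mset_0_iff)
  have "\<exists>c. f = (\<Sum>(a, S)\<in>{({#}, {0, 1})}. monomial (c a S) a S)"
  proof (rule monomial_expansion)
    show "0 \<notin># a \<and> finite S" if "(a, S) \<in> {({#}, {0, 1})}" for a :: "nat multiset" and S :: "nat set"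
      using that by auto
  qed (simp, rule h)
  then obtain c :: "nat multiset \<Rightarrow> nat set \<Rightarrow> cinf"
    where "f = monomial (c {#} {0, 1}) {#} {0, 1}" by auto
  then show "\<exists>c. f = func c * (theta 0 * theta 1)"
    unfolding monomial_low monomial_empty by blast
next
  assume f: "f \<in> acomp 2 2"
  have h: "(a, S) \<in> {({#1#}, {0, 1}), ({#}, {0, 2})}" if "coeff f a S \<noteq> 0" for a S
    by (rule coeff_acomp_cases[OF f that]) (auto simp: Pow_insert sum_mset_eq_0 sum_mset_eq_1 simp del: sum_mset_0_iff)
  have "\<exists>c. f = (\<Sum>(a, S)\<in>{({#1#}, {0, 1}), ({#}, {0, 2})}. monomial (c a S) a S)"
  proof (rule monomial_expansion)
    show "0 \<notin># a \<and> finite S" if "(a, S) \<in> {({#1#}, {0, 1}), ({#}, {0, 2})}" for a :: "nat multiset" and S :: "nat set"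
      using that by auto
  qed (simp, rule h)
  then obtain c :: "nat multiset \<Rightarrow> nat set \<Rightarrow> cinf"
    where "f = monomial (c {#1#} {0, 1}) {#1#} {0, 1} + monomial (c {#} {0, 2}) {#} {0, 2}" by auto
  then show "\<exists>c e. f = func c * (upos 1 * (theta 0 * theta 1)) + func e * (theta 0 * theta 2)"
    unfolding monomial_low monomial_empty by blast
next
  assume f: "f \<in> acomp 3 3"
  have h: "(a, S) \<in> {({#}, {0, 1, 2})}" if "coeff f a S \<noteq> 0" for a S
    by (rule coeff_acomp_cases[OF f that]) (auto simp: Pow_insert sum_mset_eq_0 sum_mset_eq_1 simp del: sum_mset_0_iff)
  have "\<exists>c. f = (\<Sum>(a, S)\<in>{({#}, {0, 1, 2})}. monomial (c a S) a S)"
  proof (rule monomial_expansion)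
    show "0 \<notin># a \<and> finite S" if "(a, S) \<in> {({#}, {0, 1, 2})}" for a :: "nat multiset" and S :: "nat set"
      using that by auto
  qed (simp, rule h)
  then obtain c :: "nat multiset \<Rightarrow> nat set \<Rightarrow> cinf"
    where "f = monomial (c {#} {0, 1, 2}) {#} {0, 1, 2}" by auto
  then show "\<exists>c. f = func c * (theta 0 * (theta 1 * theta 2))"
    unfolding monomial_low monomial_empty by blast
qed

section \<open>Primitives of smooth functions on the real line\<close>

lemma cderiv_surj: "\<exists>F. cderiv F = f"
proof -
  have s: "smooth (cfun f)" using cfun[of f] by simp
  \<comment> \<open>Continuity gives a primitive on the whole line by the fundamental theorem of
    calculus; it is smooth because its derivative is.\<close>
  have "isCont (cfun f) x" for x
    using smooth_field_differentiable[OF s, of x] by (rule field_differentiable_imp_continuous_at)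
  then obtain F where F: "\<And>x. (F has_vector_derivative cfun f x) (at x)"
    using einterval_antiderivative[of "- \<infinity>" "\<infinity>" "cfun f"] by auto
  then have D: "(F has_field_derivative cfun f x) (at x)" for x
    by (simp add: has_real_derivative_iff_has_vector_derivative)
  then have dF: "deriv F = cfun f" by (auto simp: fun_eq_iff intro: DERIV_imp_deriv)
  have "cdiff n F" for n
  proof (cases n)
    case (Suc m)
    then show ?thesis
      using s D by (auto simp: cdiff_Suc dF smooth_iff_cdiff field_differentiable_def)
  qed simp
  then have F': "smooth F" by (simp add: smooth_iff_cdiff)
  have "cderiv (Cinf F) = f"
    by (rule cinf_eqI) (simp add: cderiv.rep_eq Cinf_inverse F' dF)
  then show ?thesis ..
qed

lemma cderiv_eq_0:
  assumes "cderiv f = 0"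
  shows "\<exists>r. f = r *\<^sub>R 1"
proof -
  have s: "smooth (cfun f)" using cfun[of f] by simp
  have d0: "deriv (cfun f) x = 0" for x using assms by transfer (simp add: fun_eq_iff)
  have "DERIV (cfun f) x :> deriv (cfun f) x" for x
    using smooth_field_differentiable[OF s, of x] by (simp add: DERIV_deriv_iff_field_differentiable)
  then have "cfun f x = cfun f 0" for x
    by (intro DERIV_isconst_all) (simp add: d0)
  then have "f = cfun f 0 *\<^sub>R 1"
    by (intro cinf_eqI) (simp add: scaleR_cinf.rep_eq one_cinf.rep_eq)
  then show ?thesis ..
qed

section \<open>Explicit differentials, cocycles and coboundaries in low bidegree\<close>

lemma func_add: "func (c + e) = func c + func e"
  by (rule ahat_eqI) (simp add: func.rep_eq monc_def coeff_simps)

lemma func_diff: "func (c - e) = func c - func e"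
  by (rule ahat_eqI) (simp add: func.rep_eq monc_def coeff_simps)

lemma func_scaleR: "func (r *\<^sub>R c) = r *\<^sub>R func c"
  by (rule ahat_eqI) (simp add: func.rep_eq monc_def coeff_simps)

lemma D1_u1_theta0:
  "D1 (func c * (upos 1 * theta 0)) =
    - (func (cderiv c) * (upos 1 * (theta 0 * theta 1)) + func c * (theta 0 * theta 2))"
  by (simp add: D1_rules D1_gens polys_intros twist_def super_func super_upos normal_order mult.assoc
      numeral_2_eq_2 algebra_simps)

lemma D1_func_theta1: "D1 (func c * theta 1) = 0"
  by (simp add: D1_rules D1_gens polys_intros normal_order mult.assoc)

text \<open>\<open>D1\<close> kills the \<open>theta 1\<close> term of \<open>D2 (func c)\<close>,
  so the result is half of \<open>D1_u1_theta0\<close> taken for the derivative of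
  \<open>c\<close>.\<close>

lemma D1_D2_func:
  "D1 (D2 (func c)) = (- 1 / 2) *\<^sub>R
    (func (cderiv (cderiv c)) * (upos 1 * (theta 0 * theta 1)) + func (cderiv c) * (theta 0 * theta 2))"
proof -
  have "D2 (func c) = func (coord * cderiv c) * theta 1 + (1/2) *\<^sub>R (func (cderiv c) * (upos 1 * theta 0))"
    by (simp add: D2_gens D2u_def uvar_0 uvar_Suc distrib_right mult.assoc normal_order)
  moreover have "D1 (func (coord * cderiv c) * theta 1 + (1/2) *\<^sub>R (func (cderiv c) * (upos 1 * theta 0))) =
      D1 (func (coord * cderiv c) * theta 1) + (1/2) *\<^sub>R D1 (func (cderiv c) * (upos 1 * theta 0))"
    by (simp only: D1_rules polys_intros)
  ultimately show ?thesis
    unfolding D1_func_theta1 D1_u1_theta0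
    by (simp only: add_0 scaleR_minus_right minus_divide_left[symmetric] scaleR_minus_left)
qed

lemma D1_theta012:
  "D1 (func c * (upos 1 * (theta 0 * theta 1)) + func e * (theta 0 * theta 2)) =
    func (c - cderiv e) * (theta 0 * (theta 1 * theta 2))"
  by (simp add: D1_rules D1_gens polys_intros twist_def super_func super_upos super_theta normal_order mult.assoc
    numeral_2_eq_2 func_diff algebra_simps)

lemma D2_func_theta1:
  "D2 (func c * theta 1) = (1/2) *\<^sub>R
    (func (cderiv c) * (upos 1 * (theta 0 * theta 1)) + func c * (theta 0 * theta 2))"
  by (simp add: D2_rules D2_gens D2u_def D2theta_def uvar_0 uvar_Suc tot_rules tot_gens polys_intros twist_def
      super_func normal_order mult.assoc numeral_2_eq_2 algebra_simps)

text \<open>The homotopy formula applies although \<open>p > d\<close>: \<open>dtheta 1\<close>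
  leads to degree -1, so \<open>diag theta1_weight x = 0\<close>, and the weight
  \<open>size a - 1/2\<close> never vanishes.\<close>

lemma cycles_1_0:
  assumes "x \<in> bh_cycles 1 0"
  shows "x = 0"
proof -
  have x: "x \<in> acomp 1 0" "D1 x = 0" "D2 x = 0" using assms by (auto simp: bh_cycles_def)
  have xp: "x \<in> polys" by (rule acomp_polys[OF x(1)])
  have "dtheta (Suc 0) x \<in> acomp 0 (-1)" using acomp_dtheta[OF x(1), of 1] by simp
  then have "dtheta (Suc 0) x = 0" by (rule acomp_trivial[rotated]) simp
  then have "diag theta1_weight x = 0"
    using dtheta_D2_shift[OF xp] D2_shift_eq[OF xp] x by (simp add: deriv_zero[OF deriv_D2_shift])
  show ?thesis
  proof (rule ahat_eqI, rule ccontr)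
    fix a S assume "coeff x a S \<noteq> coeff 0 a S"
    then have nz: "coeff x a S \<noteq> 0" by (simp add: coeff_simps)
    have "coeff (diag theta1_weight x) a S = 0" by (simp add: \<open>diag theta1_weight x = 0\<close> coeff_simps)
    then have "theta1_weight a S = 0" using nz by simp
    moreover have "card S = 1" "mdeg a S = 0" using acompD[OF x(1) nz] by auto
    ultimately have "real (2 * size a) = real 1" by (simp add: theta1_weight_def)
    then have "2 * size a = 1" by (simp only: of_nat_eq_iff)
    then show False by presburger
  qed
qed

lemma monomial_sum_eq_0:
  assumes "monomial c a S + monomial e b T = 0" "0 \<notin># a" "finite S" "0 \<notin># b" "finite T" "(a, S) \<noteq> (b, T)"
  shows "e = 0"
proof -
  have "coeff (monomial c a S + monomial e b T) b T = 0" using assms(1) by (simp add: coeff_simps)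
  moreover have "\<not> (b = a \<and> T = S)" using assms(6) by auto
  ultimately show ?thesis using assms(2-5) by (simp add: coeff_simps coeff_monomial)
qed

text \<open>\<open>D1\<close> kills the \<open>theta 1\<close> term and returns \<open>c\<close> up
  to sign as the coefficient of \<open>theta 0 * theta 2\<close>, so \<open>c = 0\<close>. After
  that \<open>D2\<close> returns \<open>e / 2\<close> in the same place.\<close>

lemma cycles_1_1:
  assumes "x \<in> bh_cycles 1 1"
  shows "x = 0"
proof -
  have x: "x \<in> acomp 1 1" "D1 x = 0" "D2 x = 0" using assms by (auto simp: bh_cycles_def)
  obtain c e where ce: "x = func c * (upos 1 * theta 0) + func e * theta 1"
    using acomp_low(2)[OF x(1)] by blast
  have "D1 x = D1 (func c * (upos 1 * theta 0)) + D1 (func e * theta 1)"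
    unfolding ce by (intro D1_rules polys_intros)
  then have "monomial (cderiv c) {#1#} {0, 1} + monomial c {#} {0, 2} = 0"
    unfolding D1_u1_theta0 D1_func_theta1 x monomial_low by (metis add.right_neutral neg_equal_0_iff_equal)
  then have "c = 0" by (rule monomial_sum_eq_0) auto
  then have x': "x = func e * theta 1" by (simp add: ce func_zero)
  then have "monomial (cderiv e) {#1#} {0, 1} + monomial e {#} {0, 2} = 0"
    using x(3) unfolding x' D2_func_theta1 monomial_low by simp
  then have "e = 0" by (rule monomial_sum_eq_0) auto
  then show ?thesis by (simp add: x' func_zero)
qed

text \<open>Closedness under \<open>D1\<close> forces \<open>c\<close> to be the derivative of
  \<open>e\<close>. By \<open>D1_D2_func\<close> the element is then \<open>-2\<close> times
  \<open>D1 (D2 F)\<close> for a primitive \<open>F\<close> of \<open>e\<close>.\<close>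

lemma cycles_2_2:
  assumes "x \<in> bh_cycles 2 2"
  shows "x \<in> bh_bounds 2 2"
proof -
  have x: "x \<in> acomp 2 2" "D1 x = 0" using assms by (auto simp: bh_cycles_def)
  obtain c e where ce: "x = func c * (upos 1 * (theta 0 * theta 1)) + func e * (theta 0 * theta 2)"
    using acomp_low(4)[OF x(1)] by blast
  have "monomial (c - cderiv e) {#} {0, 1, 2} = 0"
    using x(2) unfolding ce D1_theta012 monomial_low .
  then have c: "c = cderiv e" using monomial_eq_0[of "{#}" "{0, 1, 2}" "c - cderiv e"] by simp
  obtain F where F: "cderiv F = e" using cderiv_surj by blast
  have Fp: "func F \<in> polys" "D2 (func F) \<in> polys" using derivD(1)[OF deriv_D2] by auto
  have "x = (- 2) *\<^sub>R D1 (D2 (func F))"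
    unfolding D1_D2_func F ce c by simp
  also have "\<dots> = D1 (D2 ((- 2) *\<^sub>R func F))"
    using Fp by (simp only: D1_rules D2_rules)
  finally have "x = D1 (D2 ((- 2) *\<^sub>R func F))" .
  moreover have "(- 2) *\<^sub>R func F \<in> acomp (2 - 2) (2 - 2)" using acomp_scaleR[OF acomp_func, of "- 2" F] by simp
  ultimately show ?thesis unfolding bh_bounds_def by (rule image_eqI)
qed

text \<open>On bidegree (1, 1) the image of \<open>D1\<close> already consists of elements
  \<open>2 D1 (D2 F)\<close>, with \<open>F\<close> a primitive of the coefficient of
  \<open>u^1 theta 0\<close>. Anticommutation and \<open>D2_D2\<close> show that a further
  \<open>D2\<close> kills them.\<close>

lemma bounds_3_3:
  assumes "x \<in> bh_bounds 3 3"
  shows "x = 0"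
proof -
  obtain z where z: "z \<in> acomp 1 1" "x = D1 (D2 z)" using assms by (auto simp: bh_bounds_def)
  have zp: "z \<in> polys" by (rule acomp_polys[OF z(1)])
  obtain c e where ce: "z = func c * (upos 1 * theta 0) + func e * theta 1"
    using acomp_low(2)[OF z(1)] by blast
  obtain F where F: "cderiv F = c" using cderiv_surj by blast
  have Fp: "func F \<in> polys" "D2 (func F) \<in> polys" "D1 (D2 (func F)) \<in> polys"
    using derivD(1)[OF deriv_D2] derivD(1)[OF deriv_D1] by auto
  have "D1 z = D1 (func c * (upos 1 * theta 0)) + D1 (func e * theta 1)"
    unfolding ce by (intro D1_rules polys_intros)
  also have "\<dots> = 2 *\<^sub>R D1 (D2 (func F))"
    unfolding D1_D2_func F D1_u1_theta0 D1_func_theta1 by simp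
  finally have "D2 (D1 z) = 2 *\<^sub>R D2 (D1 (D2 (func F)))"
    using Fp by (simp only: D2_rules)
  also have "\<dots> = - 2 *\<^sub>R D1 (D2 (D2 (func F)))"
    using Fp by (simp add: D1_D2)
  also have "\<dots> = 0" using Fp by (simp add: D2_D2 D1_rules)
  finally show ?thesis using z(2) zp by (simp add: D1_D2)
qed

section \<open>The cohomology groups\<close>

lemma subspace_bounds: "subspace (bh_bounds p d)"
proof (rule subspaceI)
  show "0 \<in> bh_bounds p d"
    unfolding bh_bounds_def using acomp_0 D1_rules(6) D2_rules(6) by (metis image_eqI)
next
  fix x y assume "x \<in> bh_bounds p d" "y \<in> bh_bounds p d"
  then obtain z z' where z: "z \<in> acomp (p - 2) (d - 2)" "x = D1 (D2 z)" "z' \<in> acomp (p - 2) (d - 2)" "y = D1 (D2 z')"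
    unfolding bh_bounds_def by blast
  then have "x + y = D1 (D2 (z + z'))"
    using derivD(1)[OF deriv_D2] by (simp add: D1_rules D2_rules acomp_polys)
  then show "x + y \<in> bh_bounds p d"
    unfolding bh_bounds_def using acomp_add z by blast
next
  fix r x assume "x \<in> bh_bounds p d"
  then obtain z where z: "z \<in> acomp (p - 2) (d - 2)" "x = D1 (D2 z)"
    unfolding bh_bounds_def by blast
  then have "r *\<^sub>R x = D1 (D2 (r *\<^sub>R z))"
    using derivD(1)[OF deriv_D2] by (simp add: D1_rules D2_rules acomp_polys)
  then show "r *\<^sub>R x \<in> bh_bounds p d"
    unfolding bh_bounds_def using acomp_scaleR z by blast
qed

lemma bh_class_eqI:
  assumes "x - y \<in> bh_bounds p d"
  shows "bh_class p d x = bh_class p d y"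
proof -
  note B = subspace_bounds[of p d]
  have "\<exists>b'. x + b = y + b' \<and> b' \<in> bh_bounds p d" if "b \<in> bh_bounds p d" for b
    using subspace_add[OF B assms that] by (intro exI[of _ "x - y + b"]) simp
  moreover have "\<exists>b'. y + b = x + b' \<and> b' \<in> bh_bounds p d" if "b \<in> bh_bounds p d" for b
    using subspace_diff[OF B that assms] by (intro exI[of _ "b - (x - y)"]) simp
  ultimately show ?thesis unfolding bh_class_def by blast
qed

text \<open>Here \<open>V\<close> is a complement of the coboundaries in the cocycles. The
  compatibility with sums and multiples is coset arithmetic, valid because the coboundaries form a
  subspace.\<close>

lemma BH_represented_byI:
  assumes V: "subspace V" "V \<subseteq> bh_cycles p d"
    and inj: "\<And>v. v \<in> V \<Longrightarrow> v \<in> bh_bounds p d \<Longrightarrow> v = 0"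
    and surj: "\<And>x. x \<in> bh_cycles p d \<Longrightarrow> \<exists>v\<in>V. x - v \<in> bh_bounds p d"
  shows "BH_represented_by p d V"
  unfolding BH_represented_by_def
proof (intro conjI V allI ballI)
  note B = subspace_bounds[of p d]
  have "inj_on (bh_class p d) V"
  proof (rule inj_onI)
    fix v w assume vw: "v \<in> V" "w \<in> V" "bh_class p d v = bh_class p d w"
    have "v \<in> bh_class p d v" using subspace_0[OF B] unfolding bh_class_def by force
    then obtain b where b: "b \<in> bh_bounds p d" "v = w + b" using vw(3) unfolding bh_class_def by blast
    then show "v = w" using inj[of "v - w"] subspace_diff[OF V(1) vw(1,2)] by simp
  qed
  moreover have "bh_class p d ` V = BH p d"
    unfolding BH_def
  proof
    show "bh_class p d ` bh_cycles p d \<subseteq> bh_class p d ` V"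
    proof (rule image_subsetI)
      fix x assume "x \<in> bh_cycles p d"
      then obtain v where "v \<in> V" "x - v \<in> bh_bounds p d" using surj by blast
      then show "bh_class p d x \<in> bh_class p d ` V" using bh_class_eqI by blast
    qed
  qed (use V(2) in blast)
  ultimately show "bij_betw (bh_class p d) V (BH p d)" by (simp add: bij_betw_def)
  show "bh_class p d (x + y) = bh_add (bh_class p d x) (bh_class p d y)" for x y
  proof
    show "bh_class p d (x + y) \<subseteq> bh_add (bh_class p d x) (bh_class p d y)"
    proof
      fix t assume "t \<in> bh_class p d (x + y)"
      then obtain b where b: "b \<in> bh_bounds p d" "t = (x + b) + (y + 0)"
        by (auto simp: bh_class_def algebra_simps)
      then show "t \<in> bh_add (bh_class p d x) (bh_class p d y)"
        using subspace_0[OF B] unfolding bh_add_def bh_class_def by blast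
    qed
    show "bh_add (bh_class p d x) (bh_class p d y) \<subseteq> bh_class p d (x + y)"
    proof
      fix t assume "t \<in> bh_add (bh_class p d x) (bh_class p d y)"
      then obtain b b' where b: "b \<in> bh_bounds p d" "b' \<in> bh_bounds p d" "t = (x + b) + (y + b')"
        by (auto simp: bh_class_def bh_add_def)
      then have "t = (x + y) + (b + b')" by (simp add: algebra_simps)
      then show "t \<in> bh_class p d (x + y)"
        using subspace_add[OF B b(1,2)] unfolding bh_class_def by blast
    qed
  qed
  show "bh_class p d (c *\<^sub>R x) = bh_scale p d c (bh_class p d x)" for c x
  proof
    show "bh_class p d (c *\<^sub>R x) \<subseteq> bh_scale p d c (bh_class p d x)"
    proof
      fix t assume "t \<in> bh_class p d (c *\<^sub>R x)"
      then obtain b where "b \<in> bh_bounds p d" "t = c *\<^sub>R (x + 0) + b"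
        by (auto simp: bh_class_def)
      then show "t \<in> bh_scale p d c (bh_class p d x)"
        using subspace_0[OF B] unfolding bh_scale_def bh_class_def by blast
    qed
    show "bh_scale p d c (bh_class p d x) \<subseteq> bh_class p d (c *\<^sub>R x)"
    proof
      fix t assume "t \<in> bh_scale p d c (bh_class p d x)"
      then obtain b b' where b: "b \<in> bh_bounds p d" "b' \<in> bh_bounds p d" "t = c *\<^sub>R (x + b) + b'"
        by (auto simp: bh_class_def bh_scale_def)
      then have "t = c *\<^sub>R x + (c *\<^sub>R b + b')" by (simp add: algebra_simps)
      then show "t \<in> bh_class p d (c *\<^sub>R x)"
        using subspace_add[OF B subspace_scale[OF B b(1)] b(2)] unfolding bh_class_def by blast
    qed
  qed
qed

lemma BH_trivialI:
  assumes "\<And>x. x \<in> bh_cycles p d \<Longrightarrow> x \<in> bh_bounds p d"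
  shows "BH_represented_by p d {0}"
  by (rule BH_represented_byI)
    (use assms in \<open>auto simp: bh_cycles_def acomp_0 deriv_zero[OF deriv_D1] deriv_zero[OF deriv_D2]\<close>)

text \<open>The preimage has negative super degree, or super degree 0 and negative standard degree,
  so it is 0.\<close>

lemma bounds_negative:
  assumes "x \<in> bh_bounds p d" "p < 2 \<or> (p = 2 \<and> d < 2)"
  shows "x = 0"
proof -
  obtain z where z: "z \<in> acomp (p - 2) (d - 2)" "x = D1 (D2 z)"
    using assms(1) by (auto simp: bh_bounds_def)
  have "z = 0" by (rule acomp_trivial[OF _ z(1)]) (use assms(2) in auto)
  then show ?thesis by (simp add: z(2) deriv_zero[OF deriv_D1] deriv_zero[OF deriv_D2])
qed

lemma subspace_func_times: "subspace {func f * m | f. True}"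
proof (rule subspaceI)
  show "0 \<in> {func f * m | f. True}" by (metis (mono_tags) func_zero mem_Collect_eq mult_zero_left)
  show "x + y \<in> {func f * m | f. True}" if "x \<in> {func f * m | f. True}" "y \<in> {func f * m | f. True}" for x y
    using that by (auto simp flip: distrib_right func_add)
  show "r *\<^sub>R x \<in> {func f * m | f. True}" if "x \<in> {func f * m | f. True}" for r x
    using that by (auto simp: func_scaleR[symmetric] simp flip: mult_scaleR_left)
qed

lemma BH_0_0: "BH_represented_by 0 0 {c *\<^sub>R 1 | c :: real. True}"
proof (rule BH_represented_byI)
  show "subspace {c *\<^sub>R 1 :: ahat | c. True}"
    using subspace_span[of "{1 :: ahat}"] by (simp add: span_singleton full_SetCompr_eq)
  have "D1 1 = 0" "D2 1 = 0"
    by (simp_all add: one_eq_func D1_gens D2_gens cderiv_one func_zero)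
  moreover have "(1 :: ahat) \<in> acomp 0 0" by (simp add: one_eq_func acomp_func)
  ultimately show "{c *\<^sub>R 1 | c. True} \<subseteq> bh_cycles 0 0"
    by (auto simp: bh_cycles_def acomp_scaleR D1_rules D2_rules polys_one)
  show "v = 0" if "v \<in> bh_bounds 0 0" for v using bounds_negative[OF that] by simp
  fix x assume "x \<in> bh_cycles 0 0"
  then have x: "x \<in> acomp 0 0" "D1 x = 0" by (auto simp: bh_cycles_def)
  obtain c where c: "x = func c" using acomp_low(1)[OF x(1)] by blast
  \<comment> \<open>\<open>D1\<close> sends a function to its derivative times
    \<open>theta 1\<close>, so only constants are closed.\<close>
  then have "monomial (cderiv c) {#} {1} = 0"
    using x(2) by (simp add: D1_gens normal_order monomial_low(2)[simplified])
  then have "cderiv c = 0" by (rule monomial_eq_0[rotated 2]) auto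
  then obtain r where "c = r *\<^sub>R 1" using cderiv_eq_0 by blast
  then have "x = r *\<^sub>R 1" by (simp add: c func_scaleR one_eq_func)
  then show "\<exists>v\<in>{c *\<^sub>R 1 | c. True}. x - v \<in> bh_bounds 0 0"
    using subspace_0[OF subspace_bounds] by auto
qed

lemma BH_2_1: "BH_represented_by 2 1 {func f * theta 0 * theta 1 | f. True}"
proof (rule BH_represented_byI)
  show "subspace {func f * theta 0 * theta 1 | f. True}"
    unfolding mult.assoc by (rule subspace_func_times)
  show "{func f * theta 0 * theta 1 | f. True} \<subseteq> bh_cycles 2 1"
  proof clarify
    fix f
    have "func f * theta 0 * theta 1 \<in> acomp 2 1"
      using acomp_times[OF acomp_times[OF acomp_func[of f] acomp_theta[of 0]] acomp_theta[of 1]] by simp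
    \<comment> \<open>Both differentials lead to bidegree (3, 2), which is zero since three distinct
      odd factors have degree at least 3.\<close>
    moreover from acomp_D1[OF this] acomp_D2[OF this]
    have "D1 (func f * theta 0 * theta 1) = 0" "D2 (func f * theta 0 * theta 1) = 0"
      by (auto elim!: acomp_trivial[rotated])
    ultimately show "func f * theta 0 * theta 1 \<in> bh_cycles 2 1" by (simp add: bh_cycles_def)
  qed
  show "v = 0" if "v \<in> bh_bounds 2 1" for v using bounds_negative[OF that] by simp
  fix x assume "x \<in> bh_cycles 2 1"
  then show "\<exists>v\<in>{func f * theta 0 * theta 1 | f. True}. x - v \<in> bh_bounds 2 1"
    using acomp_low(3)[of x] subspace_0[OF subspace_bounds]
    by (intro bexI[of _ x]) (auto simp: bh_cycles_def mult.assoc)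
qed

lemma BH_3_3: "BH_represented_by 3 3 {func f * theta 0 * theta 1 * theta 2 | f. True}"
proof (rule BH_represented_byI)
  show "subspace {func f * theta 0 * theta 1 * theta 2 | f. True}"
    unfolding mult.assoc by (rule subspace_func_times)
  show "{func f * theta 0 * theta 1 * theta 2 | f. True} \<subseteq> bh_cycles 3 3"
  proof clarify
    fix f
    have "func f * theta 0 * theta 1 * theta 2 \<in> acomp 3 3"
      using acomp_times[OF acomp_times[OF acomp_times[OF acomp_func[of f] acomp_theta[of 0]]
        acomp_theta[of 1]] acomp_theta[of 2]] by simp
    \<comment> \<open>Both differentials lead to bidegree (4, 4), which is zero since four distinct
      odd factors have degree at least 6.\<close>
    moreover from acomp_D1[OF this] acomp_D2[OF this]
    have "D1 (func f * theta 0 * theta 1 * theta 2) = 0" "D2 (func f * theta 0 * theta 1 * theta 2) = 0"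
      by (auto elim!: acomp_trivial[rotated])
    ultimately show "func f * theta 0 * theta 1 * theta 2 \<in> bh_cycles 3 3" by (simp add: bh_cycles_def)
  qed
  show "v = 0" if "v \<in> bh_bounds 3 3" for v using bounds_3_3[OF that] .
  fix x assume "x \<in> bh_cycles 3 3"
  then show "\<exists>v\<in>{func f * theta 0 * theta 1 * theta 2 | f. True}. x - v \<in> bh_bounds 3 3"
    using acomp_low(5)[of x] subspace_0[OF subspace_bounds]
    by (intro bexI[of _ x]) (auto simp: bh_cycles_def mult.assoc)
qed

lemma BH_trivial:
  fixes p d :: int
  assumes "p \<ge> 0" "d \<ge> 0" "(p, d) \<notin> {(0, 0), (2, 1), (3, 3)}"
  shows "BH_represented_by p d {0}"
proof (rule BH_trivialI)
  fix x assume x: "x \<in> bh_cycles p d"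
  then have xc: "x \<in> acomp p d" "D1 x = 0" "D2 x = 0" by (auto simp: bh_cycles_def)
  have z: "0 \<in> bh_bounds p d" by (rule subspace_0[OF subspace_bounds])
  \<comment> \<open>Otherwise \<open>p (p - 1) \<le> 2 d \<le> 2 p\<close>, which forces
    \<open>p \<le> 3\<close>. For \<open>p = 0\<close> and \<open>p = 3\<close> only the excluded
    \<open>d = p\<close> remains, for \<open>p = 2\<close> only \<open>d = 2\<close> besides the
    excluded \<open>d = 1\<close>.\<close>
  consider "p < d" | "2 * d < p * (p - 1)" | "p = 1" "d = 0" | "p = 1" "d = 1" | "p = 2" "d = 2"
  proof (cases "p < d \<or> 2 * d < p * (p - 1)")
    case False
    then have dp: "d \<le> p" "p * (p - 1) \<le> 2 * d" by auto
    have "p \<le> 3"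
    proof (rule ccontr)
      assume "\<not> p \<le> 3"
      then have "3 * p \<le> (p - 1) * p" by (intro mult_right_mono) auto
      moreover have "p * (p - 1) = (p - 1) * p" by simp
      ultimately show False using dp \<open>\<not> p \<le> 3\<close> by linarith
    qed
    then consider "p = 0" | "p = 1" | "p = 2" | "p = 3" using assms(1) by linarith
    then have "(p = 1 \<and> d = 0) \<or> (p = 1 \<and> d = 1) \<or> (p = 2 \<and> d = 2)"
      by cases (use dp assms(2,3) in \<open>simp; arith\<close>)+
    then show ?thesis using that by blast
  qed (use that in blast)
  then show "x \<in> bh_bounds p d"
  proof cases
    case 1
    obtain y where y: "y \<in> acomp (p - 2) (d - 2)" "x = D2 (D1 y)"
      using cycle_exact[OF 1 xc] by blast
    have yp: "y \<in> polys" "D2 y \<in> polys" using acomp_polys[OF y(1)] derivD(1)[OF deriv_D2] by auto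
    \<comment> \<open>\<open>cycle_exact\<close> gives the differentials in the opposite order,
      hence the sign.\<close>
    then have "x = D1 (D2 (- y))" by (simp add: y(2) D1_D2 D1_rules D2_rules)
    then show ?thesis unfolding bh_bounds_def using acomp_uminus[OF y(1)] by blast
  next
    case 2
    then show ?thesis using acomp_trivial[OF _ xc(1)] z by simp
  next
    case 3
    then show ?thesis using cycles_1_0[of x] x z by simp
  next
    case 4
    then show ?thesis using cycles_1_1[of x] x z by simp
  next
    case 5
    then show ?thesis using cycles_2_2[of x] x by simp
  qed
qed

theorem theorem11:
  fixes p d :: int
  assumes "p \<ge> 0" and "d \<ge> 0"
  shows "BH_represented_by p d
    (if p = 0 \<and> d = 0 then {c *\<^sub>R 1 | c :: real. True}
     else if p = 2 \<and> d = 1 then {func f * theta 0 * theta 1 | f. True}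
     else if p = 3 \<and> d = 3 then {func f * theta 0 * theta 1 * theta 2 | f. True}
     else {0})"
  using BH_0_0 BH_2_1 BH_3_3 BH_trivial[OF assms] by auto

end
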